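(* Let $\alpha\in(0,1)$ be a significance level. In the Gaussian linear model $Y=X\beta^\star+\xi$, $\xi\sim\mathcal N_n(0,\Sigma)$, assume that the variance-covariance matrix $\Sigma$ of the noise is known and that $R_{ii}:=X_i^\top\Sigma X_i=1$ for all $i\in\{1,\dots,p\}$. Then the Spacing test for LARS, which rejects $\mathbb H_0$ when $S\le\alpha$, is unbiased: its power under the alternative is always greater than or equal to the significance level $\alpha$, i.e. for every $\beta^\star\notin\ker(X)$, $$\mathbb P\{S\le\alpha\}\ \ge\ \alpha .$$
   Context: Let $X\in\mathbb R^{n\times p}$ be a design matrix with pairwise different columns $X_1,\dots,X_p$, let $\Sigma\in\mathbb R^{n\times n}$ be a variance-covariance matrix, let $\beta^\star\in\mathbb R^p$, and observe $Y=X\beta^\star+\xi$ with $\xi\sim\mathcal N_n(0,\Sigma)$. Put $U:=X^\top Y\sim\mathcal N_p(\mu^\star,R)$ with $\mu^\star:=X^\top X\beta^\star$ and $R:=X^\top\Sigma X$. The hypotheses are $\mathbb H_0:\ \beta^\star\in\ker(X)$ (equivalently $\mu^\star=0$) against $\mathbb H_1:\ \beta^\star\notin\ker(X)$ (equivalently $\mu^\star\ne0$). Let $(\hat\imath,\hat\varepsilon)\in\{1,\dots,p\}\times\{\pm1\}$ be the (almost surely unique) pair with $\hat\varepsilon U_{\hat\imath}=\|U\|_\infty$. Set $\lambda_1:=\hat\varepsilon U_{\hat\imath}$ and $$\lambda_2:=\max_{1\le j\le p,\ j\neq\hat\imath}\ \max\Big\{\frac{U_j-R_{j\hat\imath}U_{\hat\imath}}{1-\hat\varepsilon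 R_{j\hat\imath}},\ \frac{-U_j+R_{j\hat\imath}U_{\hat\imath}}{1+\hat\varepsilon R_{j\hat\imath}}\Big\}.$$ Let $\Phi$ be the standard normal cumulative distribution function and $\bar\Phi:=1-\Phi$. The test statistic is $S:=\bar\Phi(\lambda_1)/\bar\Phi(\lambda_2)$. *)

theory Defs
  imports "HOL-Analysis.Analysis" "HOL-Probability.Probability"
begin

definition covariance_matrix :: "real^'n^'n \<Rightarrow> bool" where
  "covariance_matrix \<Sigma> \<longleftrightarrow> transpose \<Sigma> = \<Sigma> \<and> (\<forall>a. 0 \<le> a \<bullet> (\<Sigma> *v a))"

text \<open>The normal law with mean \<open>m\<close> and variance \<open>v\<close>; for \<open>v = 0\<close> it is the Dirac mass at \<open>m\<close>.\<close>

definition normal_law :: "real \<Rightarrow> real \<Rightarrow> real measure" where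
  "normal_law m v = (if v = 0 then return borel m else density lborel (normal_density m (sqrt v)))"

text \<open>The multivariate normal law, defined through its one-dimensional projections
  so that singular covariance matrices are covered.\<close>

definition multivariate_normal ::
    "'a measure \<Rightarrow> ('a \<Rightarrow> real^'n) \<Rightarrow> real^'n \<Rightarrow> real^'n^'n \<Rightarrow> bool" where
  "multivariate_normal M \<xi> m \<Sigma> \<longleftrightarrow>
     covariance_matrix \<Sigma> \<and> \<xi> \<in> borel_measurable M \<and>
     (\<forall>a. distr M borel (\<lambda>\<omega>. a \<bullet> \<xi> \<omega>) = normal_law (a \<bullet> m) (a \<bullet> (\<Sigma> *v a)))"

definition std_normal_cdf :: "real \<Rightarrow> real" where
  "std_normal_cdf = cdf std_normal_distribution"

definition std_normal_tail :: "real \<Rightarrow> real" where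
  "std_normal_tail t = 1 - std_normal_cdf t"

text \<open>A signed index attaining the sup norm. Where several pairs attain it, one is chosen
  arbitrarily.\<close>

definition leading_pair :: "real^'p \<Rightarrow> 'p \<times> real" where
  "leading_pair U = (SOME (i, \<epsilon>). \<epsilon> \<in> {-1, 1} \<and> \<epsilon> * U $ i = infnorm U)"

definition lead_index :: "real^'p \<Rightarrow> 'p" where
  "lead_index U = fst (leading_pair U)"

definition lead_sign :: "real^'p \<Rightarrow> real" where
  "lead_sign U = snd (leading_pair U)"

definition lars_knot1 :: "real^'p \<Rightarrow> real" where
  "lars_knot1 U = lead_sign U * U $ lead_index U"

text \<open>For a single predictor the maximum is over the empty set; the LARS path then has no
  second positive knot and ends at \<open>0\<close>. When a denominator vanishes, i.e.
  \<open>R $ j $ i = \<plusminus>\<epsilon>\<close>, the corresponding numerator is nonpositive and the other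
  entry of the inner maximum is nonnegative, so that Isabelle's \<open>x / 0 = 0\<close> leaves that
  maximum the same as for the value \<open>-\<infinity>\<close>.\<close>

definition lars_knot2 :: "real^'p^'p \<Rightarrow> real^'p \<Rightarrow> real" where
  "lars_knot2 R U =
     (let i = lead_index U; \<epsilon> = lead_sign U in
      if UNIV - {i} = {} then 0
      else Max ((\<lambda>j. max ((U $ j - R $ j $ i * U $ i) / (1 - \<epsilon> * R $ j $ i))
                         ((- U $ j + R $ j $ i * U $ i) / (1 + \<epsilon> * R $ j $ i)))
                ` (UNIV - {i})))"

definition spacing_statistic :: "real^'p^'p \<Rightarrow> real^'p \<Rightarrow> real" where
  "spacing_statistic R U = std_normal_tail (lars_knot1 U) / std_normal_tail (lars_knot2 R U)"

end

theory Submission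
  imports Defs
begin

text \<open>
  The score vector \<open>U = X\<^sup>T Y\<close> is Gaussian with mean \<open>\<mu> = X\<^sup>T X \<beta>\<close> and covariance
  \<open>R = X\<^sup>T \<Sigma> X\<close>, which has unit diagonal but may be singular. Write \<open>T\<close> for the standard normal
  tail and \<open>g\<close> for the threshold with \<open>T (g l) = \<alpha> * T l\<close>, so that the test rejects exactly
  when \<open>\<lambda>\<^sub>1 \<ge> g \<lambda>\<^sub>2\<close>.

  Fix a signed index \<open>p = (i, \<epsilon>)\<close>. The coordinate \<open>z = \<epsilon> * U\<^sub>i\<close> is \<open>N(m, 1)\<close> with
  \<open>m = \<epsilon> * \<mu>\<^sub>i\<close> and is independent of the residual \<open>V\<close> with entries \<open>U\<^sub>j - R\<^sub>j\<^sub>i * U\<^sub>i\<close>.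
  On the event that \<open>p\<close> leads, the second knot \<open>l\<close> is a function of \<open>V\<close>, and (apart from a
  condition on \<open>V\<close> alone) the event is \<open>z \<ge> l\<close>. Given such a \<open>V\<close>,
  \<open>p\<close> leads with probability \<open>T (l - m)\<close>, and it leads and the test rejects with probability
  \<open>T (g l - m)\<close>. The function
  \<open>l \<mapsto> T (g l - m)\<close> is the integral over \<open>[l, \<infinity>)\<close> of \<open>\<alpha>\<close> times the
  \<open>N(m, 1)\<close> density times \<open>exp (m * (g t - t))\<close>; the inequality
  \<open>exp x \<ge> 1 + x\<close> gives \<open>shifted_rejection_lower_bound\<close>, and integrating over \<open>V\<close> and summing over
  the signed indices gives

  \<open>P (S \<le> \<alpha>) - \<alpha> \<ge> \<alpha> * E (D * w \<lambda>\<^sub>1)\<close>, where \<open>D = \<epsilon> * \<mu>\<^sub>i\<close> at the leading pair and \<open>w t = g t - t > 0\<close>.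

  The term for a single signed index may be negative, but \<open>D\<close> is a subgradient of the sup norm
  at \<open>U\<close> paired with \<open>\<mu>\<close>, so that \<open>D * w \<lambda>\<^sub>1\<close> is formally the derivative along \<open>\<mu>\<close> of \<open>W\<close> of the sup norm,
  where \<open>W\<close> is an antiderivative of \<open>w\<close>. Since \<open>W\<close> increases, the expectation is nonnegative as soon as the sup
  norm of \<open>s * \<mu> + noise\<close> grows stochastically with \<open>s \<ge> 0\<close>: this is Anderson's inequality for
  the cube (\<open>anderson_gaussian\<close>, used in \<open>infnorm_directional_moment_nonneg\<close>).

  Two tools carry the Gaussian part. A law on a Euclidean space is determined by its
  one-dimensional projections (\<open>prob_eqI_cos\<close>), which yields the independence of \<open>z\<close> and \<open>V\<close>
  (\<open>mvn_decomposition\<close>). Anderson's inequality follows from log-concavity of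
  \<open>u \<mapsto> P (u + noise \<in> K)\<close>: peeling off one Gaussian direction at a time reduces it to the
  one-dimensional Prekopa--Leindler inequality, in which all superlevel sets are intervals.

  When \<open>R\<close> is singular, several signed indices may attain the sup norm with positive probability.
  Any two of them tie almost surely or almost never, so the pair picked among them is, almost surely,
  determined by the event that it leads (\<open>leading_pair_almost_determined\<close>).
\<close>

section \<open>Laws determined by their projections\<close>

lemma (in prob_space) integral_cos_shift:
  assumes [measurable]: "f \<in> borel_measurable M"
  shows "(LINT x|M. cos (\<theta> + f x)) = Re (iexp \<theta> * (CLINT x|M. iexp (f x)))"
proof -
  have int: "integrable M (\<lambda>x. iexp (f x))"
    by (rule integrable_const_bound[where B = 1]) auto
  have "(LINT x|M. cos (\<theta> + f x)) = (LINT x|M. Re (iexp \<theta> * iexp (f x)))"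
    by (intro Bochner_Integration.integral_cong refl) (simp add: exp_Euler cos_add cos_of_real sin_of_real)
  also have "\<dots> = Re (CLINT x|M. iexp \<theta> * iexp (f x))"
    using int by (intro integral_Re integrable_mult_right) auto
  finally show ?thesis by simp
qed

lemma integral_cos_std_normal:
  "(LINT z|std_normal_distribution. cos (\<theta> + s * z)) = cos \<theta> * exp (- s\<^sup>2 / 2)"
proof -
  interpret real_distribution std_normal_distribution by (rule real_dist_normal_dist)
  have "(LINT z|std_normal_distribution. cos (\<theta> + s * z))
      = Re (iexp \<theta> * char std_normal_distribution s)"
    unfolding char_def by (rule integral_cos_shift) simp
  also have "\<dots> = cos \<theta> * exp (- s\<^sup>2 / 2)"
    unfolding char_std_normal_distribution exp_Euler cos_of_real sin_of_real by (simp del: of_real_exp)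
  finally show ?thesis .
qed

text \<open>This covers the degenerate law \<open>v = 0\<close> as well, so that facts on normal laws need no case
  distinction on the variance.\<close>

lemma normal_law_affine:
  assumes "0 \<le> v"
  shows "normal_law m v = distr std_normal_distribution borel (\<lambda>z. m + sqrt v * z)"
proof (cases "v = 0")
  case True
  interpret real_distribution std_normal_distribution by (rule real_dist_normal_dist)
  show ?thesis using True distr_const[of m borel] by (simp add: normal_law_def)
next
  case False
  with assms have v: "0 < sqrt v" by simp
  interpret real_distribution std_normal_distribution by (rule real_dist_normal_dist)
  have "distributed std_normal_distribution lborel (\<lambda>z. z) (normal_density 0 1)"
    by (auto simp: distributed_def intro!: distr_id2)
  from normal_density_affine[OF this, of "sqrt v" m] v
  have "distributed std_normal_distribution lborel (\<lambda>z. m + sqrt v * z) (normal_density m (sqrt v))"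
    by simp
  then have "density lborel (normal_density m (sqrt v))
      = distr std_normal_distribution lborel (\<lambda>z. m + sqrt v * z)"
    by (simp add: distributed_def)
  also have "\<dots> = distr std_normal_distribution borel (\<lambda>z. m + sqrt v * z)"
    by (rule distr_cong) auto
  finally show ?thesis using False by (simp add: normal_law_def)
qed

lemma integral_cos_normal_law:
  assumes "0 \<le> v"
  shows "(LINT z|normal_law m v. cos (\<theta> + s * z)) = cos (\<theta> + s * m) * exp (- s\<^sup>2 * v / 2)"
proof -
  have "(LINT z|normal_law m v. cos (\<theta> + s * z))
      = (LINT z|std_normal_distribution. cos ((\<theta> + s * m) + (s * sqrt v) * z))"
    unfolding normal_law_affine[OF assms] by (subst integral_distr) (auto simp: algebra_simps)
  then show ?thesis
    using assms unfolding integral_cos_std_normal by (simp add: power_mult_distrib)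
qed

lemma prob_space_normal_law: "0 \<le> v \<Longrightarrow> prob_space (normal_law m v)"
  unfolding normal_law_affine
  by (intro prob_space.prob_space_distr real_distribution.axioms(1) real_dist_normal_dist) auto

lemma sets_normal_law [measurable_cong, simp]: "sets (normal_law m v) = sets borel"
  by (simp add: normal_law_def)

text \<open>Reweighting a law by a bounded density and projecting gives an honest law on the line, to which
  characteristic functions apply. Real and imaginary part are both written as cosine integrals,
  because uniqueness is stated below with cosines only.\<close>

lemma tilted_projection:
  fixes P :: "'a::euclidean_space measure" and h :: "'a \<Rightarrow> real" and e :: 'a
  assumes P: "prob_space P" "sets P = sets borel"
    and h [measurable]: "h \<in> borel_measurable borel" and bd: "\<And>x. 0 \<le> h x" "\<And>x. h x \<le> 2"
    and c: "c = (LINT x|P. h x)" "0 < c"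
  defines "D \<equiv> distr (density P (\<lambda>x. ennreal (h x / c))) borel (\<lambda>x. e \<bullet> x)"
  shows "real_distribution D"
    and "Re (char D s) = (LINT x|P. h x * cos (0 + s * (e \<bullet> x))) / c"
    and "Im (char D s) = (LINT x|P. h x * cos (- pi/2 + s * (e \<bullet> x))) / c"
    and "A \<in> sets borel \<Longrightarrow> measure D A = (LINT x|P. h x * indicator A (e \<bullet> x)) / c"
proof -
  interpret P: prob_space P by fact
  have [measurable_cong]: "sets P = sets borel" by fact
  have inth: "integrable P h"
    by (rule P.integrable_const_bound[where B = 2]) (use bd in auto)
  have ps: "prob_space (density P (\<lambda>x. ennreal (h x / c)))"
  proof (rule prob_spaceI)
    have "emeasure (density P (\<lambda>x. ennreal (h x / c))) (space P) = (\<integral>\<^sup>+x. ennreal (h x / c) \<partial>P)"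
      by (subst emeasure_density) (auto intro!: nn_integral_cong)
    also have "\<dots> = ennreal (LINT x|P. h x / c)"
      using bd c inth by (intro nn_integral_eq_integral) auto
    also have "\<dots> = 1" using c by simp
    finally show "emeasure (density P (\<lambda>x. ennreal (h x / c)))
        (space (density P (\<lambda>x. ennreal (h x / c)))) = 1" by simp
  qed
  show rd: "real_distribution D"
    unfolding D_def by (rule prob_space.real_distribution_distr[OF ps]) simp
  have cf: "char D s = (CLINT x|P. (h x / c) *\<^sub>R iexp (s * (e \<bullet> x)))"
    unfolding D_def char_def using bd c
    by (subst integral_distr; simp) (subst integral_density; simp)
  have inte: "integrable P (\<lambda>x. (h x / c) *\<^sub>R iexp (s * (e \<bullet> x)))"
    by (rule P.integrable_const_bound[where B = "2 / c"]) (use bd c in \<open>auto simp: divide_right_mono\<close>)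
  show "Re (char D s) = (LINT x|P. h x * cos (0 + s * (e \<bullet> x))) / c"
    unfolding cf integral_Re[OF inte, symmetric]
    by (subst integral_divide_zero[symmetric]) (auto intro!: Bochner_Integration.integral_cong simp: exp_Euler cos_of_real sin_of_real simp flip: of_real_mult)
  show "Im (char D s) = (LINT x|P. h x * cos (- pi/2 + s * (e \<bullet> x))) / c"
    unfolding cf integral_Im[OF inte, symmetric]
    by (subst integral_divide_zero[symmetric]) (auto intro!: Bochner_Integration.integral_cong simp: exp_Euler cos_of_real sin_of_real cos_diff simp flip: of_real_mult)
  assume [measurable]: "A \<in> sets borel"
  interpret D: real_distribution D by (rule rd)
  have "measure D A = (LINT y|D. indicator A y)"
    using D.prob_space D.space_eq_univ by simp
  also have "\<dots> = (LINT x|P. (h x / c) *\<^sub>R indicator A (e \<bullet> x))"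
    unfolding D_def using bd c
    by (subst integral_distr; simp) (subst integral_density; simp)
  finally show "measure D A = (LINT x|P. h x * indicator A (e \<bullet> x)) / c"
    by simp
qed

text \<open>Levy's uniqueness theorem for the tilted projections. If the weight has total mass \<open>0\<close>, there is
  nothing to normalize and both sides vanish.\<close>

lemma weighted_projection_eqI:
  fixes P Q :: "'a::euclidean_space measure" and h :: "'a \<Rightarrow> real"
  assumes P: "prob_space P" "sets P = sets borel" and Q: "prob_space Q" "sets Q = sets borel"
    and h [measurable]: "h \<in> borel_measurable borel" and bd: "\<And>x. 0 \<le> h x" "\<And>x. h x \<le> 2"
    and eq: "\<And>\<theta> s. (LINT x|P. h x * cos (\<theta> + s * (e \<bullet> x))) = (LINT x|Q. h x * cos (\<theta> + s * (e \<bullet> x)))"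
    and A [measurable]: "A \<in> sets borel"
  shows "(LINT x|P. h x * indicator A (e \<bullet> x)) = (LINT x|Q. h x * indicator A (e \<bullet> x))"
proof -
  have [measurable_cong]: "sets P = sets borel" "sets Q = sets borel" by fact+
  define c where "c = (LINT x|P. h x)"
  have cQ: "c = (LINT x|Q. h x)" using eq[of 0 0] by (simp add: c_def)
  have zero: "(LINT x|R. h x * indicator A (e \<bullet> x)) = 0"
    if R: "prob_space R" "sets R = sets borel" "(LINT x|R. h x) = 0" for R
  proof -
    interpret R: prob_space R by fact
    have [measurable_cong]: "sets R = sets borel" by fact
    have "integrable R h" by (rule R.integrable_const_bound[where B = 2]) (use bd in auto)
    then have "AE x in R. h x = 0"
      using R bd by (subst integral_nonneg_eq_0_iff_AE[symmetric]) auto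
    then show ?thesis by (intro integral_eq_zero_AE) auto
  qed
  show ?thesis
  proof (cases "c = 0")
    case True
    then show ?thesis using zero[OF P] zero[OF Q] cQ c_def by simp
  next
    case False
    moreover have "0 \<le> c" unfolding c_def using bd by (intro Bochner_Integration.integral_nonneg) auto
    ultimately have c: "0 < c" by simp
    note TP = tilted_projection[OF P h bd c_def c, where e = e]
    note TQ = tilted_projection[OF Q h bd cQ c, where e = e]
    have "distr (density P (\<lambda>x. ennreal (h x / c))) borel (\<lambda>x. e \<bullet> x)
        = distr (density Q (\<lambda>x. ennreal (h x / c))) borel (\<lambda>x. e \<bullet> x)"
      using TP(1) TQ(1)
      by (rule Levy_uniqueness) (intro ext complex_eqI; simp only: TP(2,3) TQ(2,3) eq)
    then have "(LINT x|P. h x * indicator A (e \<bullet> x)) / c = (LINT x|Q. h x * indicator A (e \<bullet> x)) / c"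
      by (simp only: TP(4)[OF A, symmetric] TQ(4)[OF A, symmetric])
    then show ?thesis using c by simp
  qed
qed

text \<open>The theorem of Cramer and Wold, by induction over the coordinates: once indicators of the
  coordinates in \<open>J\<close> may be inserted under the cosine integral, these indicators times
  \<open>1 + cos\<close> serve as weight for the one-dimensional uniqueness theorem in a further coordinate. When
  all coordinates are treated, the two laws agree on boxes.\<close>

lemma prob_eqI_cos:
  fixes P Q :: "'a::euclidean_space measure"
  assumes P: "prob_space P" "sets P = sets borel" and Q: "prob_space Q" "sets Q = sets borel"
    and eq: "\<And>\<theta> t. (LINT x|P. cos (\<theta> + t \<bullet> x)) = (LINT x|Q. cos (\<theta> + t \<bullet> x))"
  shows "P = Q"
proof -
  have [measurable_cong]: "sets P = sets borel" "sets Q = sets borel" by fact+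
  interpret P: prob_space P by fact
  interpret Q: prob_space Q by fact
  have fin: "(LINT x|P. (\<Prod>b\<in>J. indicator (A b) (b \<bullet> x)) * cos (\<theta> + t \<bullet> x))
      = (LINT x|Q. (\<Prod>b\<in>J. indicator (A b) (b \<bullet> x)) * cos (\<theta> + t \<bullet> x))"
    if J: "finite J" and A: "\<And>b. A b \<in> sets borel" for J and A :: "'a \<Rightarrow> real set" and \<theta> t
    using J
  proof (induction J arbitrary: \<theta> t rule: finite_induct)
    case empty
    then show ?case using eq by simp
  next
    case (insert k J)
    have [measurable]: "A b \<in> sets borel" for b by (rule A)
    define F :: "'a \<Rightarrow> real" where "F x = (\<Prod>b\<in>J. indicator (A b) (b \<bullet> x))" for x
    have [measurable]: "F \<in> borel_measurable borel" unfolding F_def by measurable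
    have F01: "0 \<le> F x" "F x \<le> 1" for x
      unfolding F_def by (auto intro!: prod_nonneg prod_le_1 simp: indicator_def)
    have intb: "integrable R (\<lambda>x. F x * g x)"
      if "prob_space R" "sets R = sets borel" "g \<in> borel_measurable borel" "\<And>x. \<bar>g x\<bar> \<le> 1" for R g
    proof -
      interpret R: prob_space R by fact
      have [measurable_cong]: "sets R = sets borel" by fact
      have [measurable]: "g \<in> borel_measurable borel" by fact
      have "\<bar>F x * g x\<bar> \<le> 1" for x
        using mult_mono[of "F x" 1 "\<bar>g x\<bar>" 1] F01[of x] that(4)[of x] by (simp add: abs_mult)
      then show ?thesis by (intro R.integrable_const_bound[where B = 1]) auto
    qed
    \<comment> \<open>The weight must be nonnegative for the one-dimensional uniqueness theorem, whence the
      added constant \<open>1\<close>; products of cosines are again sums of cosines.\<close>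
    have expand: "(LINT x|R. F x * (1 + cos (\<theta> + t \<bullet> x)) * cos (\<eta> + s * (k \<bullet> x)))
        = (LINT x|R. F x * cos (\<eta> + (s *\<^sub>R k) \<bullet> x))
          + (LINT x|R. F x * cos (\<theta> - \<eta> + (t - s *\<^sub>R k) \<bullet> x)) / 2
          + (LINT x|R. F x * cos (\<theta> + \<eta> + (t + s *\<^sub>R k) \<bullet> x)) / 2"
      if R: "prob_space R" "sets R = sets borel" for R \<theta> t \<eta> s
    proof -
      have "F x * (1 + cos (\<theta> + t \<bullet> x)) * cos (\<eta> + s * (k \<bullet> x))
        = F x * cos (\<eta> + (s *\<^sub>R k) \<bullet> x)
          + F x * cos (\<theta> - \<eta> + (t - s *\<^sub>R k) \<bullet> x) / 2
          + F x * cos (\<theta> + \<eta> + (t + s *\<^sub>R k) \<bullet> x) / 2" for x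
      proof -
        have "cos (\<theta> + t \<bullet> x) * cos (\<eta> + s * (k \<bullet> x))
          = (cos (\<theta> - \<eta> + (t - s *\<^sub>R k) \<bullet> x) + cos (\<theta> + \<eta> + (t + s *\<^sub>R k) \<bullet> x)) / 2"
          unfolding cos_times_cos by (simp add: algebra_simps inner_add_left inner_diff_left)
        then show ?thesis by (simp add: algebra_simps add_divide_distrib)
      qed
      then show ?thesis
        using intb[OF R]
        by (simp add: Bochner_Integration.integral_add Bochner_Integration.integrable_add)
    qed
    have IH: "(LINT x|P. F x * cos (\<theta> + t \<bullet> x)) = (LINT x|Q. F x * cos (\<theta> + t \<bullet> x))" for \<theta> t
      using insert.IH unfolding F_def .
    have step: "(LINT x|P. F x * (1 + cos (\<theta> + t \<bullet> x)) * indicator (A k) (k \<bullet> x))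
        = (LINT x|Q. F x * (1 + cos (\<theta> + t \<bullet> x)) * indicator (A k) (k \<bullet> x))" for \<theta> t
    proof (rule weighted_projection_eqI[OF P Q])
      fix x
      have c: "0 \<le> 1 + cos (\<theta> + t \<bullet> x)" "1 + cos (\<theta> + t \<bullet> x) \<le> 2"
        using cos_ge_minus_one[of "\<theta> + t \<bullet> x"] cos_le_one[of "\<theta> + t \<bullet> x"] by linarith+
      show "0 \<le> F x * (1 + cos (\<theta> + t \<bullet> x))" using c F01 by simp
      show "F x * (1 + cos (\<theta> + t \<bullet> x)) \<le> 2" using mult_mono[OF F01(2) c(2)] c F01 by simp
      fix \<eta> s
      show "(LINT x|P. F x * (1 + cos (\<theta> + t \<bullet> x)) * cos (\<eta> + s * (k \<bullet> x)))
          = (LINT x|Q. F x * (1 + cos (\<theta> + t \<bullet> x)) * cos (\<eta> + s * (k \<bullet> x)))"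
        by (simp only: expand[OF P] expand[OF Q] IH)
    qed (auto intro: A)
    have split: "(LINT x|R. F x * (1 + cos (\<theta> + t \<bullet> x)) * indicator (A k) (k \<bullet> x))
       = (LINT x|R. F x * indicator (A k) (k \<bullet> x))
         + (LINT x|R. F x * (cos (\<theta> + t \<bullet> x) * indicator (A k) (k \<bullet> x)))"
      if R: "prob_space R" "sets R = sets borel" for R \<theta> t
      by (subst Bochner_Integration.integral_add[symmetric])
        (auto intro!: intb[OF R] Bochner_Integration.integral_cong
              simp: indicator_def algebra_simps simp del: Bochner_Integration.integral_add)
    have base: "(LINT x|P. F x * indicator (A k) (k \<bullet> x)) = (LINT x|Q. F x * indicator (A k) (k \<bullet> x))"
      using step[of "pi/2" 0] by simp
    have "(LINT x|P. F x * (cos (\<theta> + t \<bullet> x) * indicator (A k) (k \<bullet> x)))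
       = (LINT x|Q. F x * (cos (\<theta> + t \<bullet> x) * indicator (A k) (k \<bullet> x)))"
      using step[of \<theta> t] base unfolding split[OF P] split[OF Q] by simp
    then show ?case using insert.hyps by (simp add: F_def mult_ac)
  qed
  have box: "emeasure P (box l u) = emeasure Q (box l u)" for l u
  proof -
    have ind: "(\<Prod>b\<in>Basis. indicator {l \<bullet> b<..<u \<bullet> b} (b \<bullet> x)) = (indicator (box l u) x :: real)" for x
      by (auto simp: indicator_def box_def inner_commute)
    have "measure P (box l u) = measure Q (box l u)"
      using fin[of Basis "\<lambda>b. {l \<bullet> b<..<u \<bullet> b}" 0 0] by (simp add: ind P sets_eq_imp_space_eq[OF P(2)] sets_eq_imp_space_eq[OF Q(2)])
    then show ?thesis by (simp add: P.emeasure_eq_measure Q.emeasure_eq_measure)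
  qed
  show ?thesis
  proof (rule measure_eqI_generator_eq)
    let ?E = "range (\<lambda>(l, u). box l u::'a set)"
    show "Int_stable ?E" by (auto simp: Int_stable_def box_Int_box)
    show "?E \<subseteq> Pow UNIV" "sets P = sigma_sets UNIV ?E" "sets Q = sigma_sets UNIV ?E"
      by (simp_all add: borel_eq_box P Q)
    let ?A = "\<lambda>n::nat. box (- (real n *\<^sub>R One)) (real n *\<^sub>R One) :: 'a set"
    show "range ?A \<subseteq> ?E" "(\<Union>i. ?A i) = UNIV" unfolding UN_box_eq_UNIV by auto
    show "emeasure P (?A i) \<noteq> \<infinity>" for i by simp
    show "emeasure P X = emeasure Q X" if "X \<in> ?E" for X using that box by auto
  qed
qed

section \<open>Conditioning Gaussian vectors on one coordinate\<close>

lemma mvn_measurable: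
  "multivariate_normal M \<xi> m \<Sigma> \<Longrightarrow> \<xi> \<in> borel_measurable M"
  by (simp add: multivariate_normal_def)

lemma covariance_symmetric:
  assumes "covariance_matrix S"
  shows "x \<bullet> (S *v y) = (S *v x) \<bullet> y"
  using assms dot_lmul_matrix[of x S y] transpose_matrix_vector[of S x]
  by (simp add: covariance_matrix_def)

lemma mvn_integral_cos:
  assumes "multivariate_normal M \<xi> m \<Sigma>"
  shows "(LINT \<omega>|M. cos (\<theta> + t \<bullet> \<xi> \<omega>)) = cos (\<theta> + t \<bullet> m) * exp (- (t \<bullet> (\<Sigma> *v t)) / 2)"
proof -
  have [measurable]: "\<xi> \<in> borel_measurable M" and v: "0 \<le> t \<bullet> (\<Sigma> *v t)"
    and law: "distr M borel (\<lambda>\<omega>. t \<bullet> \<xi> \<omega>) = normal_law (t \<bullet> m) (t \<bullet> (\<Sigma> *v t))"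
    using assms by (auto simp: multivariate_normal_def covariance_matrix_def)
  have "(LINT \<omega>|M. cos (\<theta> + t \<bullet> \<xi> \<omega>)) = (LINT z|distr M borel (\<lambda>\<omega>. t \<bullet> \<xi> \<omega>). cos (\<theta> + 1 * z))"
    by (subst integral_distr) auto
  then show ?thesis unfolding law integral_cos_normal_law[OF v] by simp
qed

lemma mvn_law_eqI:
  assumes M: "prob_space M" "multivariate_normal M \<xi> m \<Sigma>"
    and N: "prob_space N" "multivariate_normal N \<eta> m \<Sigma>"
  shows "distr M borel \<xi> = distr N borel \<eta>"
proof (rule prob_eqI_cos)
  have [measurable]: "\<xi> \<in> borel_measurable M" "\<eta> \<in> borel_measurable N"
    using M N by (auto simp: multivariate_normal_def)
  show "prob_space (distr M borel \<xi>)" "prob_space (distr N borel \<eta>)"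
    using M N by (auto intro: prob_space.prob_space_distr)
  show "(LINT x|distr M borel \<xi>. cos (\<theta> + t \<bullet> x)) = (LINT x|distr N borel \<eta>. cos (\<theta> + t \<bullet> x))" for \<theta> t
    by (simp add: integral_distr mvn_integral_cos[OF M(2)] mvn_integral_cos[OF N(2)])
qed auto

lemma mvn_linear_image:
  fixes A :: "real^'n^'k"
  assumes "multivariate_normal M \<xi> m \<Sigma>"
  shows "multivariate_normal M (\<lambda>\<omega>. A *v \<xi> \<omega>) (A *v m) (A ** \<Sigma> ** transpose A)"
proof -
  have [measurable]: "\<xi> \<in> borel_measurable M" and S: "covariance_matrix \<Sigma>"
    and law: "distr M borel (\<lambda>\<omega>. a \<bullet> \<xi> \<omega>) = normal_law (a \<bullet> m) (a \<bullet> (\<Sigma> *v a))" for a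
    using assms by (auto simp: multivariate_normal_def)
  have adj: "b \<bullet> (A *v x) = (transpose A *v b) \<bullet> x" for b x
    by (simp add: dot_lmul_matrix)
  have q: "b \<bullet> ((A ** \<Sigma> ** transpose A) *v b) = (transpose A *v b) \<bullet> (\<Sigma> *v (transpose A *v b))" for b
    by (simp only: matrix_vector_mul_assoc[symmetric] adj)
  have "covariance_matrix (A ** \<Sigma> ** transpose A)"
    using S unfolding covariance_matrix_def q
    by (simp add: matrix_transpose_mul transpose_transpose matrix_mul_assoc)
  moreover have "(\<lambda>\<omega>. A *v \<xi> \<omega>) \<in> borel_measurable M"
    by (intro borel_measurable_continuous_on[where f = "\<lambda>x. A *v x"] matrix_vector_mult_linear_continuous_on) auto
  ultimately show ?thesis
    unfolding multivariate_normal_def q adj law by simp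
qed

lemma residual_covariance_apply:
  fixes R :: "real^'p^'p"
  shows "(\<chi> i j. R $ i $ j - c $ i * c $ j) *v b = R *v b - (c \<bullet> b) *\<^sub>R c"
  by (simp add: vec_eq_iff matrix_vector_mult_def inner_vec_def left_diff_distrib right_diff_distrib
      sum_subtractf sum_distrib_right sum_distrib_left mult_ac)

text \<open>Subtracting the part of \<open>U\<close> that is correlated with \<open>a \<bullet> U\<close>. The direction \<open>a\<close> is normalized so
  that \<open>a \<bullet> U\<close> has variance \<open>1\<close>, and \<open>c\<close> is then the covariance of \<open>U\<close> with \<open>a \<bullet> U\<close>.\<close>

lemma mvn_residual:
  fixes R :: "real^'p^'p"
  assumes U: "multivariate_normal M U \<mu> R" and a: "a \<bullet> (R *v a) = 1" and c: "c = R *v a"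
  shows "multivariate_normal M (\<lambda>\<omega>. U \<omega> - (a \<bullet> U \<omega>) *\<^sub>R c) (\<mu> - (a \<bullet> \<mu>) *\<^sub>R c)
           (\<chi> i j. R $ i $ j - c $ i * c $ j)" (is "multivariate_normal M ?V ?m ?S")
proof -
  have [measurable]: "U \<in> borel_measurable M" and R: "covariance_matrix R"
    and law: "distr M borel (\<lambda>\<omega>. b \<bullet> U \<omega>) = normal_law (b \<bullet> \<mu>) (b \<bullet> (R *v b))" for b
    using U by (auto simp: multivariate_normal_def)
  define p where "p b = b - (b \<bullet> c) *\<^sub>R a" for b
  have proj: "b \<bullet> (x - (a \<bullet> x) *\<^sub>R c) = p b \<bullet> x" for b x
    by (simp add: p_def inner_diff_left inner_diff_right)
  have q: "b \<bullet> (?S *v b) = p b \<bullet> (R *v p b)" for b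
  proof -
    have "R *v p b = R *v b - (b \<bullet> c) *\<^sub>R c"
      by (simp add: p_def c matrix_vector_mult_diff_distrib scaleR_matrix_vector_assoc matrix_vector_mult_scaleR)
    moreover have "a \<bullet> (R *v b) = b \<bullet> c"
      using covariance_symmetric[OF R, of a b] unfolding c by (simp only: inner_commute)
    ultimately show ?thesis
      using a unfolding c[symmetric]
      by (simp add: residual_covariance_apply p_def inner_diff_left inner_diff_right inner_commute[of c])
  qed
  have "covariance_matrix ?S"
    unfolding covariance_matrix_def q using R
    by (auto simp: covariance_matrix_def transpose_def vec_eq_iff mult_ac)
  moreover have "?V \<in> borel_measurable M" by measurable
  ultimately show ?thesis
    unfolding multivariate_normal_def proj q law by simp
qed

text \<open>Independence of \<open>a \<bullet> U\<close> and the residual \<open>V\<close>: recombining \<open>V\<close> with a fresh copy of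
  \<open>a \<bullet> U\<close> reproduces the law of \<open>U\<close>, as the cosine integrals agree.\<close>

lemma mvn_decomposition:
  fixes R :: "real^'p^'p"
  assumes M: "prob_space M" and U: "multivariate_normal M U \<mu> R"
    and a: "a \<bullet> (R *v a) = 1" and c: "c = R *v a"
  defines "V \<equiv> \<lambda>\<omega>. U \<omega> - (a \<bullet> U \<omega>) *\<^sub>R c"
  shows "distr M borel U = distr (M \<Otimes>\<^sub>M normal_law (a \<bullet> \<mu>) 1) borel (\<lambda>(\<omega>, z). z *\<^sub>R c + V \<omega>)"
proof (rule prob_eqI_cos)
  interpret M: prob_space M by fact
  interpret N: prob_space "normal_law (a \<bullet> \<mu>) 1" by (simp add: prob_space_normal_law)
  interpret pair_prob_space M "normal_law (a \<bullet> \<mu>) 1" ..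
  have [measurable]: "U \<in> borel_measurable M" by (rule mvn_measurable[OF U])
  have V: "multivariate_normal M V (\<mu> - (a \<bullet> \<mu>) *\<^sub>R c) (\<chi> i j. R $ i $ j - c $ i * c $ j)"
    unfolding V_def by (rule mvn_residual[OF U a c])
  have [measurable]: "V \<in> borel_measurable M" by (rule mvn_measurable[OF V])
  have Sv: "b \<bullet> ((\<chi> i j. R $ i $ j - c $ i * c $ j) *v b) = b \<bullet> (R *v b) - (b \<bullet> c)\<^sup>2" for b
    by (simp add: residual_covariance_apply inner_diff_right power2_eq_square inner_commute)
  show "prob_space (distr M borel U)" by (rule M.prob_space_distr) simp
  show "prob_space (distr (M \<Otimes>\<^sub>M normal_law (a \<bullet> \<mu>) 1) borel (\<lambda>(\<omega>, z). z *\<^sub>R c + V \<omega>))"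
    by (rule prob_space_distr) simp
  fix \<theta> t
  have "(LINT x|distr (M \<Otimes>\<^sub>M normal_law (a \<bullet> \<mu>) 1) borel (\<lambda>(\<omega>, z). z *\<^sub>R c + V \<omega>). cos (\<theta> + t \<bullet> x))
      = (LINT y|(M \<Otimes>\<^sub>M normal_law (a \<bullet> \<mu>) 1). cos (\<theta> + t \<bullet> (snd y *\<^sub>R c + V (fst y))))"
    by (subst integral_distr) (auto simp: case_prod_beta)
  also have "\<dots> = (LINT \<omega>|M. LINT z|normal_law (a \<bullet> \<mu>) 1. cos (\<theta> + t \<bullet> (z *\<^sub>R c + V \<omega>)))"
    by (subst integral_fst'[symmetric]) (auto intro!: integrable_const_bound[where B = 1])
  also have "\<dots> = (LINT \<omega>|M. LINT z|normal_law (a \<bullet> \<mu>) 1. cos ((\<theta> + t \<bullet> V \<omega>) + (t \<bullet> c) * z))"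
    by (simp add: inner_add_right algebra_simps)
  also have "\<dots> = (LINT \<omega>|M. cos ((\<theta> + (t \<bullet> c) * (a \<bullet> \<mu>)) + t \<bullet> V \<omega>) * exp (- (t \<bullet> c)\<^sup>2 / 2))"
    by (subst integral_cos_normal_law) (auto simp: algebra_simps)
  also have "\<dots> = cos (\<theta> + t \<bullet> \<mu>) * (exp (- (t \<bullet> (R *v t) - (t \<bullet> c)\<^sup>2) / 2) * exp (- (t \<bullet> c)\<^sup>2 / 2))"
    using mvn_integral_cos[OF V] by (simp add: Sv inner_diff_right mult_ac)
  also have "exp (- (t \<bullet> (R *v t) - (t \<bullet> c)\<^sup>2) / 2) * exp (- (t \<bullet> c)\<^sup>2 / 2) = exp (- (t \<bullet> (R *v t)) / 2)"
    by (simp add: field_simps flip: exp_add)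
  also have "cos (\<theta> + t \<bullet> \<mu>) * \<dots> = (LINT x|distr M borel U. cos (\<theta> + t \<bullet> x))"
    by (simp add: integral_distr mvn_integral_cos[OF U])
  finally show "(LINT x|distr M borel U. cos (\<theta> + t \<bullet> x))
    = (LINT x|distr (M \<Otimes>\<^sub>M normal_law (a \<bullet> \<mu>) 1) borel (\<lambda>(\<omega>, z). z *\<^sub>R c + V \<omega>). cos (\<theta> + t \<bullet> x))"
    by simp
qed auto

lemma mvn_integral_decomposition:
  fixes R :: "real^'p^'p" and f :: "real^'p \<Rightarrow> real"
  assumes M: "prob_space M" and U: "multivariate_normal M U \<mu> R"
    and a: "a \<bullet> (R *v a) = 1" and c: "c = R *v a"
    and f [measurable]: "f \<in> borel_measurable borel" and B: "\<And>x. \<bar>f x\<bar> \<le> B"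
  shows "(LINT \<omega>|M. f (U \<omega>))
    = (LINT \<omega>|M. LINT z|normal_law (a \<bullet> \<mu>) 1. f (z *\<^sub>R c + (U \<omega> - (a \<bullet> U \<omega>) *\<^sub>R c)))"
proof -
  interpret M: prob_space M by fact
  interpret N: prob_space "normal_law (a \<bullet> \<mu>) 1" by (simp add: prob_space_normal_law)
  interpret pair_prob_space M "normal_law (a \<bullet> \<mu>) 1" ..
  have [measurable]: "U \<in> borel_measurable M" by (rule mvn_measurable[OF U])
  let ?g = "\<lambda>\<omega> z. z *\<^sub>R c + (U \<omega> - (a \<bullet> U \<omega>) *\<^sub>R c)"
  have int: "integrable (M \<Otimes>\<^sub>M normal_law (a \<bullet> \<mu>) 1) (\<lambda>y. f (?g (fst y) (snd y)))"
    using B by (intro integrable_const_bound[where B = B]) auto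
  have "(LINT \<omega>|M. f (U \<omega>)) = (LINT x|distr M borel U. f x)"
    by (simp add: integral_distr)
  also have "\<dots> = (LINT y|(M \<Otimes>\<^sub>M normal_law (a \<bullet> \<mu>) 1). f (?g (fst y) (snd y)))"
    unfolding mvn_decomposition[OF M U a c] by (subst integral_distr) (auto simp: case_prod_beta)
  also have "\<dots> = (LINT \<omega>|M. LINT z|normal_law (a \<bullet> \<mu>) 1. f (?g \<omega> z))"
    using integral_fst'[OF int] by simp
  finally show ?thesis .
qed

section \<open>Log-concavity and the Prekopa--Leindler inequality\<close>

text \<open>The weight \<open>w\<close> is meant as the derivative of \<open>W\<close>; the hypothesis is the form of this that
  Tonelli's theorem needs.\<close>

lemma nn_integral_layer_cake:
  fixes f :: "'a \<Rightarrow> real" and w :: "real \<Rightarrow> real"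
  assumes "sigma_finite_measure M" and f [measurable]: "f \<in> borel_measurable M"
    and w [measurable]: "w \<in> borel_measurable borel"
    and W: "\<And>x. x \<in> space M \<Longrightarrow> ennreal (W (f x)) = (\<integral>\<^sup>+s. ennreal (w s) * indicator {0<..<f x} s \<partial>lborel)"
  shows "(\<integral>\<^sup>+x. ennreal (W (f x)) \<partial>M)
    = (\<integral>\<^sup>+s. ennreal (w s) * indicator {0<..} s * emeasure M {x \<in> space M. s < f x} \<partial>lborel)"
proof -
  interpret M: sigma_finite_measure M by fact
  interpret pair_sigma_finite M lborel ..
  have "(\<integral>\<^sup>+x. ennreal (W (f x)) \<partial>M)
      = (\<integral>\<^sup>+x. (\<integral>\<^sup>+s. ennreal (w s) * indicator {0<..} s * indicator {s. s < f x} s \<partial>lborel) \<partial>M)"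
    using W by (intro nn_integral_cong) (auto intro!: nn_integral_cong simp: indicator_def)
  also have "\<dots> = (\<integral>\<^sup>+s. (\<integral>\<^sup>+x. ennreal (w s) * indicator {0<..} s * indicator {s. s < f x} s \<partial>M) \<partial>lborel)"
    by (rule Fubini'[symmetric]) (simp add: indicator_def)
  also have "\<dots> = (\<integral>\<^sup>+s. ennreal (w s) * indicator {0<..} s * emeasure M {x \<in> space M. s < f x} \<partial>lborel)"
  proof (rule nn_integral_cong)
    fix s :: real
    have "(\<integral>\<^sup>+x. ennreal (w s) * indicator {0<..} s * indicator {s. s < f x} s \<partial>M)
        = (\<integral>\<^sup>+x. ennreal (w s) * indicator {0<..} s * indicator {x \<in> space M. s < f x} x \<partial>M)"
      by (intro nn_integral_cong) (auto simp: indicator_def)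
    also have "\<dots> = ennreal (w s) * indicator {0<..} s * emeasure M {x \<in> space M. s < f x}"
      by (rule nn_integral_cmult_indicator) measurable
    finally show "(\<integral>\<^sup>+x. ennreal (w s) * indicator {0<..} s * indicator {s. s < f x} s \<partial>M)
        = ennreal (w s) * indicator {0<..} s * emeasure M {x \<in> space M. s < f x}" .
  qed
  finally show ?thesis .
qed

lemma weighted_am_gm:
  fixes a b t :: real
  assumes "0 < t" "t < 1" "0 \<le> a" "0 \<le> b"
  shows "a powr (1 - t) * b powr t \<le> (1 - t) * a + t * b"
  using Youngs_inequality_0[of "1 - t" t a b] assms by (cases "a = 0 \<or> b = 0") (auto simp: mult_ac)

lemma interval_measure_bounds:
  fixes A :: "real set"
  assumes "convex A" "bounded A" "A \<noteq> {}"
  shows "emeasure lborel A \<le> ennreal (Sup A - Inf A)" "Inf A \<le> Sup A" "{Inf A<..<Sup A} \<subseteq> A"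
proof -
  have bdd: "bdd_above A" "bdd_below A" using assms bounded_imp_bdd_above bounded_imp_bdd_below by auto
  show le: "Inf A \<le> Sup A" using assms bdd cInf_le_cSup by blast
  have "A \<subseteq> {Inf A..Sup A}" using bdd by (auto intro: cInf_lower cSup_upper)
  then have "emeasure lborel A \<le> emeasure lborel {Inf A..Sup A}" by (intro emeasure_mono) auto
  then show "emeasure lborel A \<le> ennreal (Sup A - Inf A)" using le by simp
  show "{Inf A<..<Sup A} \<subseteq> A"
  proof
    fix x assume x: "x \<in> {Inf A<..<Sup A}"
    then obtain u v where "u \<in> A" "u < x" "v \<in> A" "x < v"
      using cInf_lessD[OF assms(3), of x] less_cSupD[OF assms(3), of x] by auto
    then show "x \<in> A" using assms(1) unfolding is_interval_convex_1[symmetric] by (meson is_interval_1 less_imp_le)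
  qed
qed

text \<open>The Brunn--Minkowski inequality on the line, for intervals: an interval between the
  combinations of the infima and of the suprema lies in \<open>C\<close>.\<close>

lemma interval_combination_measure:
  fixes A B C :: "real set"
  assumes A: "convex A" "bounded A" "A \<noteq> {}" and B: "convex B" "bounded B" "B \<noteq> {}"
    and C: "C \<in> sets borel" and t: "0 < t" "t < 1"
    and comb: "\<And>a b. a \<in> A \<Longrightarrow> b \<in> B \<Longrightarrow> (1 - t) * a + t * b \<in> C"
  shows "ennreal (1 - t) * emeasure lborel A + ennreal t * emeasure lborel B \<le> emeasure lborel C"
proof -
  note mA = interval_measure_bounds[OF A] and mB = interval_measure_bounds[OF B]
  let ?l = "(1 - t) * Inf A + t * Inf B" and ?r = "(1 - t) * Sup A + t * Sup B"
  have lr: "?l \<le> ?r" using mA(2) mB(2) t by (intro add_mono mult_left_mono) auto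
  have point: "Inf S + \<theta> * (Sup S - Inf S) \<in> S"
    if S: "convex S" "bounded S" "S \<noteq> {}" and \<theta>: "0 < \<theta>" "\<theta> < 1" for S :: "real set" and \<theta> :: real
  proof (cases "Inf S = Sup S")
    case True
    obtain x where "x \<in> S" using S by auto
    moreover have "Inf S \<le> x" "x \<le> Sup S"
      using \<open>x \<in> S\<close> bounded_imp_bdd_above[OF S(2)] bounded_imp_bdd_below[OF S(2)]
      by (auto intro: cInf_lower cSup_upper)
    ultimately show ?thesis using True by simp
  next
    case False
    then have "0 < Sup S - Inf S" using interval_measure_bounds(2)[OF S] by simp
    moreover from this have "\<theta> * (Sup S - Inf S) < 1 * (Sup S - Inf S)"
      using \<theta> by (intro mult_strict_right_mono) auto
    moreover have "0 < \<theta> * (Sup S - Inf S)" using calculation(1) \<theta> by simp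
    moreover have "Inf S + e \<in> {Inf S<..<Sup S}" if "0 < e" "e < 1 * (Sup S - Inf S)" for e
      using that by simp
    ultimately have "Inf S + \<theta> * (Sup S - Inf S) \<in> {Inf S<..<Sup S}" by blast
    then show ?thesis using interval_measure_bounds(3)[OF S] by blast
  qed
  \<comment> \<open>A point of the interval is the combination of the points of \<open>A\<close> and \<open>B\<close> at the same relative position \<open>\<theta>\<close>.\<close>
  have "{?l<..<?r} \<subseteq> C"
  proof
    fix x assume x: "x \<in> {?l<..<?r}"
    define \<theta> where "\<theta> = (x - ?l) / (?r - ?l)"
    have \<theta>: "0 < \<theta>" "\<theta> < 1" using x by (auto simp: \<theta>_def)
    have "x = ?l + \<theta> * (?r - ?l)" using x by (auto simp: \<theta>_def)
    also have "\<dots> = (1 - t) * (Inf A + \<theta> * (Sup A - Inf A)) + t * (Inf B + \<theta> * (Sup B - Inf B))"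
      by (simp add: algebra_simps)
    finally show "x \<in> C" using comb[OF point[OF A \<theta>] point[OF B \<theta>]] by simp
  qed
  then have "emeasure lborel {?l<..<?r} \<le> emeasure lborel C"
    using C by (intro emeasure_mono) auto
  moreover have "ennreal (1 - t) * emeasure lborel A + ennreal t * emeasure lborel B
      \<le> ennreal (1 - t) * ennreal (Sup A - Inf A) + ennreal t * ennreal (Sup B - Inf B)"
    using mA(1) mB(1) by (intro add_mono mult_left_mono) auto
  moreover have "\<dots> = ennreal (?r - ?l)"
  proof -
    have "?r - ?l = (1 - t) * (Sup A - Inf A) + t * (Sup B - Inf B)" by (simp add: algebra_simps)
    moreover have "0 \<le> Sup A - Inf A" "0 \<le> Sup B - Inf B" using mA(2) mB(2) by simp_all
    ultimately show ?thesis using t by (simp only: ennreal_plus ennreal_mult mult_nonneg_nonneg diff_ge_0_iff_ge less_imp_le)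
  qed
  ultimately show ?thesis using lr by simp
qed

text \<open>The geometric mean is written with \<open>powr\<close>, and \<open>0 powr t = 0\<close> makes the inequality hold
  trivially where \<open>f\<close> vanishes.\<close>

definition log_concave :: "('a::real_vector \<Rightarrow> real) \<Rightarrow> bool" where
  "log_concave f \<longleftrightarrow> (\<forall>x. 0 \<le> f x) \<and>
     (\<forall>x y t. 0 < t \<longrightarrow> t < 1 \<longrightarrow> f x powr (1 - t) * f y powr t \<le> f ((1 - t) *\<^sub>R x + t *\<^sub>R y))"

lemma log_concaveD:
  assumes "log_concave f"
  shows "0 \<le> f x" "0 < t \<Longrightarrow> t < 1 \<Longrightarrow> f x powr (1 - t) * f y powr t \<le> f ((1 - t) *\<^sub>R x + t *\<^sub>R y)"
  using assms by (auto simp: log_concave_def)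

lemma geo_mean_gt:
  fixes a b s t :: real
  assumes "0 < t" "t < 1" "0 \<le> s" "s < a" "s < b"
  shows "s < a powr (1 - t) * b powr t"
proof (cases "s = 0")
  case True
  then show ?thesis using assms by simp
next
  case False
  then have "s = s powr (1 - t) * s powr t" using assms by (simp flip: powr_add)
  also have "\<dots> < a powr (1 - t) * b powr t"
    using assms False by (intro mult_strict_mono powr_less_mono2) auto
  finally show ?thesis .
qed

lemma log_concave_superlevel_convex:
  assumes "log_concave f" "0 \<le> s"
  shows "convex {x. s < f x}"
proof (rule convexI)
  fix x y and u v :: real
  assume xy: "x \<in> {x. s < f x}" "y \<in> {x. s < f x}" and uv: "0 \<le> u" "0 \<le> v" "u + v = 1"
  show "u *\<^sub>R x + v *\<^sub>R y \<in> {x. s < f x}"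
  proof (cases "u = 0 \<or> v = 0")
    case True
    then show ?thesis using xy uv by auto
  next
    case False
    then have v: "0 < v" "v < 1" "u = 1 - v" using uv by auto
    then show ?thesis
      using geo_mean_gt[of v s "f x" "f y"] log_concaveD(2)[OF assms(1), of v x y] xy assms(2) by auto
  qed
qed

text \<open>Divide \<open>f\<close> and \<open>g\<close> by their suprema, and \<open>h\<close> accordingly. The superlevel sets at a height below \<open>1\<close>
  are then nonempty intervals, the one of \<open>h\<close> contains the weighted combination of the others, and
  integrating the lengths over the height bounds the integral of \<open>h\<close> below by an arithmetic mean,
  hence by the geometric mean.\<close>

lemma prekopa_leindler:
  fixes f g h :: "real \<Rightarrow> real"
  assumes f: "log_concave f" "integrable lborel f" "bdd_above (range f)" "\<And>s. 0 < s \<Longrightarrow> bounded {x. s < f x}"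
    and g: "log_concave g" "integrable lborel g" "bdd_above (range g)" "\<And>s. 0 < s \<Longrightarrow> bounded {x. s < g x}"
    and h: "\<And>x. 0 \<le> h x" "integrable lborel h"
    and t: "0 < t" "t < 1"
    and le: "\<And>x y. f x powr (1 - t) * g y powr t \<le> h ((1 - t) * x + t * y)"
  shows "(LINT x|lborel. f x) powr (1 - t) * (LINT x|lborel. g x) powr t \<le> (LINT x|lborel. h x)"
proof (cases "(LINT x|lborel. f x) = 0 \<or> (LINT x|lborel. g x) = 0")
  case True
  then show ?thesis using h by (auto intro: Bochner_Integration.integral_nonneg)
next
  case False
  define a where "a = Sup (range f)"
  define b where "b = Sup (range g)"
  have pos: "0 < Sup (range k)" if k: "log_concave k" "bdd_above (range k)" "(LINT x|lborel. k x) \<noteq> 0"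
    for k :: "real \<Rightarrow> real"
  proof (rule ccontr)
    assume *: "\<not> 0 < Sup (range k)"
    have "k x = 0" for x
      using cSup_upper[OF rangeI k(2), of x] * log_concaveD(1)[OF k(1), of x] by linarith
    then show False using k(3) by simp
  qed
  have a: "0 < a" and b: "0 < b" unfolding a_def b_def using pos f g False by auto
  define m where "m = a powr (1 - t) * b powr t"
  have m: "0 < m" using a b by (simp add: m_def)
  have [measurable]: "f \<in> borel_measurable borel" "g \<in> borel_measurable borel" "h \<in> borel_measurable borel"
    using f(2) g(2) h(2) by auto
  have layer: "(\<integral>\<^sup>+x. ennreal (k x / c) \<partial>lborel)
      = (\<integral>\<^sup>+s. indicator {0<..} s * emeasure lborel {x. s < k x / c} \<partial>lborel)"
    if [measurable]: "k \<in> borel_measurable borel" and "\<And>x. 0 \<le> k x" "0 < c" for k :: "real \<Rightarrow> real" and c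
    using nn_integral_layer_cake[where M = lborel and w = "\<lambda>_. 1" and W = "\<lambda>y. y" and f = "\<lambda>x. k x / c"] that
    by (simp add: sigma_finite_lborel)
  have empty: "{x. s < k x / Sup (range k)} = {}" if "1 \<le> s" "0 < Sup (range k)" "bdd_above (range k)"
    for s and k :: "real \<Rightarrow> real"
  proof -
    have "k x / Sup (range k) \<le> 1" for x using cSup_upper[OF rangeI that(3), of x] that by simp
    then show ?thesis using that(1) by (auto simp: not_less intro: order_trans)
  qed
  have nonempty: "{x. s < k x / Sup (range k)} \<noteq> {}" if "s < 1" "0 < Sup (range k)" "bdd_above (range k)"
    for s and k :: "real \<Rightarrow> real"
  proof -
    have "s * Sup (range k) < Sup (range k)" using that by simp
    then obtain x where "s * Sup (range k) < k x" using less_cSupD[of "range k"] by auto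
    then show ?thesis using that by (auto simp: pos_less_divide_eq)
  qed
  have slice: "ennreal (1 - t) * emeasure lborel {x. s < f x / a} + ennreal t * emeasure lborel {x. s < g x / b}
      \<le> emeasure lborel {x. s < h x / m}" if s: "0 < s" for s
  proof (cases "s < 1")
    case True
    have eqf: "{x. s < f x / a} = {x. s * a < f x}" and eqg: "{x. s < g x / b} = {x. s * b < g x}"
      using a b by (auto simp: pos_less_divide_eq)
    show ?thesis
    proof (rule interval_combination_measure[OF _ _ _ _ _ _ _ t])
      show "convex {x. s < f x / a}" "convex {x. s < g x / b}"
        unfolding eqf eqg using f g s a b by (auto intro!: log_concave_superlevel_convex)
      show "bounded {x. s < f x / a}" "bounded {x. s < g x / b}"
        unfolding eqf eqg using f g s a b by auto
      show "{x. s < f x / a} \<noteq> {}" "{x. s < g x / b} \<noteq> {}"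
        unfolding a_def b_def using nonempty[OF True] a b f g by (auto simp: a_def b_def)
      show "{x. s < h x / m} \<in> sets borel" by measurable
      fix x y assume "x \<in> {x. s < f x / a}" "y \<in> {x. s < g x / b}"
      then have "s < (f x / a) powr (1 - t) * (g y / b) powr t"
        using geo_mean_gt[OF t, of s "f x / a" "g y / b"] s by simp
      also have "\<dots> = f x powr (1 - t) * g y powr t / m"
        using a b log_concaveD(1)[OF f(1)] log_concaveD(1)[OF g(1)] by (simp add: m_def powr_divide)
      also have "\<dots> \<le> h ((1 - t) * x + t * y) / m" using le m by (simp add: divide_right_mono)
      finally show "(1 - t) * x + t * y \<in> {x. s < h x / m}" by simp
    qed
  next
    case False
    then show ?thesis using empty[of s f] empty[of s g] a b f g by (simp add: a_def b_def)
  qed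
  have conv: "(\<integral>\<^sup>+x. ennreal (k x / c) \<partial>lborel) = ennreal ((LINT x|lborel. k x) / c)"
    if "integrable lborel k" "\<And>x. 0 \<le> k x" "0 < c" for k :: "real \<Rightarrow> real" and c
    using that by (subst nn_integral_eq_integral) auto
  have If: "0 \<le> (LINT x|lborel. f x)" and Ig: "0 \<le> (LINT x|lborel. g x)" and Ih: "0 \<le> (LINT x|lborel. h x)"
    using log_concaveD(1)[OF f(1)] log_concaveD(1)[OF g(1)] h by (auto intro!: Bochner_Integration.integral_nonneg)
  have "ennreal ((1 - t) * ((LINT x|lborel. f x) / a) + t * ((LINT x|lborel. g x) / b))
     = ennreal (1 - t) * (\<integral>\<^sup>+x. ennreal (f x / a) \<partial>lborel) + ennreal t * (\<integral>\<^sup>+x. ennreal (g x / b) \<partial>lborel)"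
    using t a b If Ig conv[OF f(2) log_concaveD(1)[OF f(1)] a] conv[OF g(2) log_concaveD(1)[OF g(1)] b]
    by (simp add: ennreal_mult[symmetric] del: times_divide_eq_right)
  also have "\<dots> = (\<integral>\<^sup>+s. ennreal (1 - t) * (indicator {0<..} s * emeasure lborel {x. s < f x / a})
        + ennreal t * (indicator {0<..} s * emeasure lborel {x. s < g x / b}) \<partial>lborel)"
    using a b log_concaveD(1)[OF f(1)] log_concaveD(1)[OF g(1)]
    by (subst nn_integral_add) (auto simp: layer nn_integral_cmult)
  also have "\<dots> \<le> (\<integral>\<^sup>+s. indicator {0<..} s * emeasure lborel {x. s < h x / m} \<partial>lborel)"
    using slice by (intro nn_integral_mono) (auto simp: indicator_def)
  also have "\<dots> = (\<integral>\<^sup>+x. ennreal (h x / m) \<partial>lborel)" using h m by (simp add: layer)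
  also have "\<dots> = ennreal ((LINT x|lborel. h x) / m)" using conv[OF h(2,1) m] .
  finally have "(1 - t) * ((LINT x|lborel. f x) / a) + t * ((LINT x|lborel. g x) / b) \<le> (LINT x|lborel. h x) / m"
    using m Ih by (simp add: ennreal_le_iff)
  moreover have "((LINT x|lborel. f x) / a) powr (1 - t) * ((LINT x|lborel. g x) / b) powr t
      \<le> (1 - t) * ((LINT x|lborel. f x) / a) + t * ((LINT x|lborel. g x) / b)"
    using t a b If Ig by (intro weighted_am_gm) auto
  moreover have "((LINT x|lborel. f x) / a) powr (1 - t) * ((LINT x|lborel. g x) / b) powr t
      = (LINT x|lborel. f x) powr (1 - t) * (LINT x|lborel. g x) powr t / m"
    using a b If Ig by (simp add: m_def powr_divide)
  ultimately have "(LINT x|lborel. f x) powr (1 - t) * (LINT x|lborel. g x) powr t / m \<le> (LINT x|lborel. h x) / m"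
    by linarith
  then show ?thesis using m by (simp add: divide_le_cancel)
qed

lemma log_concave_mult:
  assumes "log_concave f" "log_concave g"
  shows "log_concave (\<lambda>x. f x * g x)"
  unfolding log_concave_def
proof (intro conjI allI impI)
  fix x y and t :: real assume t: "0 < t" "t < 1"
  note F = log_concaveD[OF assms(1)] and G = log_concaveD[OF assms(2)]
  have "(f x * g x) powr (1 - t) * (f y * g y) powr t
      = (f x powr (1 - t) * f y powr t) * (g x powr (1 - t) * g y powr t)"
    using F(1) G(1) by (simp add: powr_mult mult_ac)
  also have "\<dots> \<le> f ((1 - t) *\<^sub>R x + t *\<^sub>R y) * g ((1 - t) *\<^sub>R x + t *\<^sub>R y)"
    using F G t by (intro mult_mono) auto
  finally show "(f x * g x) powr (1 - t) * (f y * g y) powr t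
      \<le> f ((1 - t) *\<^sub>R x + t *\<^sub>R y) * g ((1 - t) *\<^sub>R x + t *\<^sub>R y)" .
qed (use log_concaveD(1)[OF assms(1)] log_concaveD(1)[OF assms(2)] in auto)

lemma log_concave_indicator:
  assumes "convex K"
  shows "log_concave (indicator K :: _ \<Rightarrow> real)"
  using assms convexD[OF assms] by (auto simp: log_concave_def indicator_def)

lemma log_concave_std_normal_density: "log_concave std_normal_density"
  unfolding log_concave_def
proof (intro conjI allI impI)
  fix x y t :: real assume t: "0 < t" "t < 1"
  define k :: real where "k = 1 / sqrt (2 * pi)"
  have k: "0 < k" by (simp add: k_def)
  have d: "std_normal_density z = k * exp (- z\<^sup>2 / 2)" for z
    by (simp add: std_normal_density_def k_def)
  have "((1 - t) * x + t * y)\<^sup>2 \<le> (1 - t) * x\<^sup>2 + t * y\<^sup>2"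
  proof -
    have "(1 - t) * x\<^sup>2 + t * y\<^sup>2 - ((1 - t) * x + t * y)\<^sup>2 = t * (1 - t) * (x - y)\<^sup>2" by algebra
    moreover have "0 \<le> t * (1 - t) * (x - y)\<^sup>2" using t by simp
    ultimately show ?thesis by linarith
  qed
  then have "exp ((1 - t) * (- x\<^sup>2 / 2) + t * (- y\<^sup>2 / 2)) \<le> exp (- ((1 - t) * x + t * y)\<^sup>2 / 2)"
    by simp
  moreover have pw: "(k * exp u) powr s = k powr s * exp (s * u)" for u s
    using k by (simp add: powr_mult exp_powr_real mult.commute)
  moreover have "(k * exp (- x\<^sup>2 / 2)) powr (1 - t) * (k * exp (- y\<^sup>2 / 2)) powr t
      = (k powr (1 - t) * k powr t) * exp ((1 - t) * (- x\<^sup>2 / 2) + t * (- y\<^sup>2 / 2))"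
    by (simp only: pw exp_add mult_ac)
  moreover have "k powr (1 - t) * k powr t = k" using k by (simp flip: powr_add)
  ultimately show "std_normal_density x powr (1 - t) * std_normal_density y powr t
      \<le> std_normal_density ((1 - t) *\<^sub>R x + t *\<^sub>R y)"
    using k unfolding d by simp
qed simp

section \<open>Anderson's inequality for Gaussian vectors\<close>

lemma borel_measurable_component [measurable (raw)]:
  "f \<in> borel_measurable M \<Longrightarrow> (\<lambda>\<omega>. (f \<omega> :: real^'n) $ i) \<in> borel_measurable M"
  by (rule borel_measurable_continuous_on[where f = "\<lambda>x. x $ i"]) (auto intro: continuous_intros)

text \<open>The point \<open>s *\<^sub>R x\<close> lies between \<open>x\<close> and \<open>- x\<close>, where \<open>F\<close> takes the same value.\<close>

lemma log_concave_even_le: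
  assumes F: "log_concave F" "\<And>x. F (- x) = F x" and s: "0 \<le> s" "s \<le> 1"
  shows "F x \<le> F (s *\<^sub>R x)"
proof (cases "s = 1")
  case False
  define t where "t = (1 - s) / 2"
  have t: "0 < t" "t < 1" using False s by (auto simp: t_def)
  have "F x = F x powr (1 - t) * F (- x) powr t"
    using t log_concaveD(1)[OF F(1), of x] F(2) by (cases "F x = 0") (auto simp flip: powr_add)
  also have "\<dots> \<le> F ((1 - t) *\<^sub>R x + t *\<^sub>R (- x))" by (rule log_concaveD(2)[OF F(1) t])
  also have "(1 - t) *\<^sub>R x + t *\<^sub>R (- x) = s *\<^sub>R x"
    by (simp add: t_def scaleR_diff_left[symmetric] del: scaleR_diff_left)
  finally show ?thesis .
qed simp

lemma log_concave_affine_line: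
  assumes "log_concave F"
  shows "log_concave (\<lambda>z::real. F (x + z *\<^sub>R c))"
  unfolding log_concave_def
proof (intro conjI allI impI)
  fix a b t :: real assume t: "0 < t" "t < 1"
  have "(1 - t) *\<^sub>R (x + a *\<^sub>R c) + t *\<^sub>R (x + b *\<^sub>R c) = x + ((1 - t) *\<^sub>R a + t *\<^sub>R b) *\<^sub>R c"
    by (simp add: algebra_simps)
  then show "F (x + a *\<^sub>R c) powr (1 - t) * F (x + b *\<^sub>R c) powr t \<le> F (x + ((1 - t) *\<^sub>R a + t *\<^sub>R b) *\<^sub>R c)"
    using log_concaveD(2)[OF assms t, of "x + a *\<^sub>R c" "x + b *\<^sub>R c"] by simp
qed (use log_concaveD(1)[OF assms] in auto)

lemma std_normal_superlevel_bounded: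
  assumes s: "0 < s" and f: "\<And>z. f z \<le> std_normal_density z"
  shows "bounded {z. s < f z}"
proof -
  have "((\<lambda>z. std_normal_density z) \<longlongrightarrow> 0) at_infinity"
  proof -
    have "((\<lambda>z. std_normal_density z) \<longlongrightarrow> 0) at_top" "((\<lambda>z. std_normal_density z) \<longlongrightarrow> 0) at_bot"
      unfolding std_normal_density_def by real_asymp+
    then show ?thesis by (simp add: at_infinity_eq_at_top_bot filterlim_sup)
  qed
  then have "\<forall>\<^sub>F z in at_infinity. std_normal_density z < s" using s by (rule order_tendstoD)
  then obtain b where b: "\<And>z. b \<le> norm z \<Longrightarrow> std_normal_density z < s"
    unfolding eventually_at_infinity by auto
  have "norm z \<le> b" if "s < f z" for z
    using b[of z] f[of z] that by (meson le_cases less_asym less_le_trans)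
  then show ?thesis unfolding bounded_iff by auto
qed

text \<open>Prekopa's theorem for one Gaussian direction: the integrand is jointly log-concave in \<open>x\<close> and \<open>z\<close>,
  and integrating out the real variable \<open>z\<close> preserves log-concavity.\<close>

lemma log_concave_gaussian_average:
  fixes F :: "'a::euclidean_space \<Rightarrow> real"
  assumes F: "log_concave F" "F \<in> borel_measurable borel" "\<And>x. F x \<le> 1"
  shows "log_concave (\<lambda>x. LINT z|std_normal_distribution. F (x + z *\<^sub>R c))"
proof -
  have [measurable]: "F \<in> borel_measurable borel" by fact
  define f where "f x z = F (x + z *\<^sub>R c) * std_normal_density z" for x z
  have [measurable]: "f x \<in> borel_measurable borel" for x unfolding f_def by measurable
  have F0: "0 \<le> F x" for x by (rule log_concaveD(1)[OF F(1)])
  have f0: "0 \<le> f x z" for x z using F0 by (simp add: f_def)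
  have fle: "f x z \<le> std_normal_density z" for x z
    using mult_right_mono[OF F(3)[of "x + z *\<^sub>R c"], of "std_normal_density z"] by (simp add: f_def)
  have flc: "log_concave (f x)" for x
    unfolding f_def by (intro log_concave_mult log_concave_affine_line F log_concave_std_normal_density)
  have fint: "integrable lborel (f x)" for x
    by (rule Bochner_Integration.integrable_bound[OF integrable_normal_density[of 1 0]])
      (use f0 fle in auto)
  have fbd: "bdd_above (range (f x))" for x
  proof (rule bdd_aboveI[where M = 1], clarify)
    fix z
    have "exp (- z\<^sup>2 / 2) / sqrt (2 * pi) \<le> 1 / 1"
      using pi_gt3 by (intro frac_le) auto
    then have "std_normal_density z \<le> 1" by (simp add: std_normal_density_def)
    then show "f x z \<le> 1" using fle[of x z] by (rule order_trans[rotated])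
  qed
  have eq: "(LINT z|std_normal_distribution. F (x + z *\<^sub>R c)) = (LINT z|lborel. f x z)" for x
    using integral_density[of "\<lambda>z. F (x + z *\<^sub>R c)" lborel std_normal_density]
    by (simp add: f_def mult.commute)
  show ?thesis
    unfolding eq unfolding log_concave_def
  proof (intro conjI allI impI)
    fix x y and t :: real assume t: "0 < t" "t < 1"
    show "(LINT z|lborel. f x z) powr (1 - t) * (LINT z|lborel. f y z) powr t
        \<le> (LINT z|lborel. f ((1 - t) *\<^sub>R x + t *\<^sub>R y) z)"
    proof (rule prekopa_leindler[OF flc fint fbd _ flc fint fbd _ f0 fint t])
      fix a b :: real
      have *: "(1 - t) *\<^sub>R (x + a *\<^sub>R c) + t *\<^sub>R (y + b *\<^sub>R c)
          = ((1 - t) *\<^sub>R x + t *\<^sub>R y) + ((1 - t) * a + t * b) *\<^sub>R c"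
        by (simp add: algebra_simps)
      have "f x a powr (1 - t) * f y b powr t
          = (F (x + a *\<^sub>R c) powr (1 - t) * F (y + b *\<^sub>R c) powr t)
            * (std_normal_density a powr (1 - t) * std_normal_density b powr t)"
        using F0 by (simp add: f_def powr_mult mult_ac)
      also have "\<dots> \<le> F (((1 - t) *\<^sub>R x + t *\<^sub>R y) + ((1 - t) * a + t * b) *\<^sub>R c)
            * std_normal_density ((1 - t) * a + t * b)"
        using log_concaveD(2)[OF F(1) t, of "x + a *\<^sub>R c" "y + b *\<^sub>R c"]
          log_concaveD(2)[OF log_concave_std_normal_density t, of a b] F0
        unfolding * by (intro mult_mono) auto
      finally show "f x a powr (1 - t) * f y b powr t \<le> f ((1 - t) *\<^sub>R x + t *\<^sub>R y) ((1 - t) * a + t * b)"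
        by (simp add: f_def)
    qed (auto intro: std_normal_superlevel_bounded fle)
  qed (auto intro: Bochner_Integration.integral_nonneg f0)
qed

lemma mvn_coordinate_law:
  assumes "multivariate_normal M U \<mu> R"
  shows "distr M borel (\<lambda>\<omega>. U \<omega> $ i) = normal_law (\<mu> $ i) (R $ i $ i)"
proof -
  have "distr M borel (\<lambda>\<omega>. axis i 1 \<bullet> U \<omega>) = normal_law (axis i 1 \<bullet> \<mu>) (axis i 1 \<bullet> (R *v axis i 1))"
    using assms by (simp add: multivariate_normal_def)
  then show ?thesis by (simp add: inner_axis' matrix_vector_mult_basis column_def)
qed

lemma covariance_diagonal_nonneg:
  assumes "covariance_matrix R"
  shows "0 \<le> R $ i $ i"
proof -
  have "0 \<le> axis i 1 \<bullet> (R *v axis i 1)" using assms by (simp add: covariance_matrix_def)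
  then show ?thesis by (simp add: inner_axis' matrix_vector_mult_basis column_def)
qed

text \<open>Induction on the number of nondegenerate coordinates. Splitting off a coordinate of positive
  variance replaces \<open>F\<close> by its average in one direction and \<open>\<xi>\<close> by a residual in which that
  coordinate has become degenerate.\<close>

lemma mvn_translation_log_concave:
  fixes R :: "real^'p^'p" and F :: "real^'p \<Rightarrow> real"
  assumes "prob_space M" "multivariate_normal M \<xi> 0 R"
    and "log_concave F" "F \<in> borel_measurable borel" "\<And>x. F x \<le> 1"
  shows "log_concave (\<lambda>u. LINT \<omega>|M. F (u + \<xi> \<omega>))"
  using assms(2-)
proof (induction "card {i. R $ i $ i \<noteq> 0}" arbitrary: \<xi> R F rule: less_induct)
  case less
  interpret M: prob_space M by fact
  note xi = less.prems(1) and F = less.prems(2-)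
  have [measurable]: "\<xi> \<in> borel_measurable M" "F \<in> borel_measurable borel"
    using xi F by (auto simp: multivariate_normal_def)
  have R: "covariance_matrix R" using xi by (simp add: multivariate_normal_def)
  show ?case
  proof (cases "{i. R $ i $ i \<noteq> 0} = {}")
    case True
    have "AE \<omega> in M. \<xi> \<omega> $ i = 0" for i
    proof -
      have "AE x in distr M borel (\<lambda>\<omega>. \<xi> \<omega> $ i). x = 0"
      proof -
        have "R $ i $ i = 0" using True by blast
        then have "normal_law ((0::real^'p) $ i) (R $ i $ i) = return borel 0" by (simp add: normal_law_def)
        then show ?thesis unfolding mvn_coordinate_law[OF xi] by (simp only:) (subst AE_return; simp)
      qed
      then show ?thesis by (rule AE_distrD[rotated]) measurable
    qed
    then have "AE \<omega> in M. \<forall>i. \<xi> \<omega> $ i = 0" by (subst AE_all_countable) auto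
    then have zero: "AE \<omega> in M. \<xi> \<omega> = 0" by eventually_elim (simp add: vec_eq_iff)
    have "(LINT \<omega>|M. F (u + \<xi> \<omega>)) = (LINT \<omega>|M. F u)" for u
      using zero by (intro integral_cong_AE) auto
    then show ?thesis using F M.prob_space by simp
  next
    case False
    then obtain i where i: "R $ i $ i \<noteq> 0" by auto
    have Rii: "0 < R $ i $ i" using i covariance_diagonal_nonneg[OF R, of i] by simp
    define a :: "real^'p" where "a = axis i (1 / sqrt (R $ i $ i))"
    define c where "c = R *v a"
    have ax: "a = (1 / sqrt (R $ i $ i)) *\<^sub>R axis i 1" by (simp add: a_def vec_eq_iff axis_def)
    have Ra: "c $ j = R $ j $ i / sqrt (R $ i $ i)" for j
      unfolding c_def ax by (simp add: matrix_vector_mult_scaleR matrix_vector_mult_basis column_def)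
    have a1: "a \<bullet> (R *v a) = 1"
      using Rii unfolding c_def[symmetric] by (simp add: a_def inner_axis' Ra)
    define V where "V \<omega> = \<xi> \<omega> - (a \<bullet> \<xi> \<omega>) *\<^sub>R c" for \<omega>
    define S :: "real^'p^'p" where "S = (\<chi> j k. R $ j $ k - c $ j * c $ k)"
    have V: "multivariate_normal M V 0 S"
      using mvn_residual[OF xi a1 c_def] by (simp add: V_def[abs_def] S_def)
    have Sdiag: "S $ j $ j = R $ j $ j - (c $ j)\<^sup>2" for j by (simp add: S_def power2_eq_square)
    have "{j. S $ j $ j \<noteq> 0} \<subset> {j. R $ j $ j \<noteq> 0}"
    proof
      show "{j. S $ j $ j \<noteq> 0} \<subseteq> {j. R $ j $ j \<noteq> 0}"
      proof clarify
        fix j assume "S $ j $ j \<noteq> 0" "R $ j $ j = 0"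
        moreover have "0 \<le> S $ j $ j"
          using V covariance_diagonal_nonneg by (auto simp: multivariate_normal_def)
        ultimately show False by (simp add: Sdiag)
      qed
      have "(c $ i)\<^sup>2 = R $ i $ i" using Rii by (simp add: Ra power_divide power2_eq_square)
      then have "S $ i $ i = 0" by (simp add: Sdiag)
      then show "{j. S $ j $ j \<noteq> 0} \<noteq> {j. R $ j $ j \<noteq> 0}" using i by auto
    qed
    then have card: "card {j. S $ j $ j \<noteq> 0} < card {j. R $ j $ j \<noteq> 0}" by (intro psubset_card_mono) auto
    define G where "G x = (LINT z|std_normal_distribution. F (x + z *\<^sub>R c))" for x
    interpret N: real_distribution std_normal_distribution by (rule real_dist_normal_dist)
    have G: "log_concave G" unfolding G_def using F by (rule log_concave_gaussian_average)
    have Gm: "G \<in> borel_measurable borel" unfolding G_def by measurable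
    have G1: "G x \<le> 1" for x
      unfolding G_def using F by (intro N.integral_le_const N.integrable_const_bound[where B = 1])
        (auto simp: log_concaveD(1))
    have std: "normal_law 0 1 = std_normal_distribution" by (simp add: normal_law_def)
    have bd: "\<bar>F x\<bar> \<le> 1" for x using log_concaveD(1)[OF F(1)] F(3) by (simp add: abs_le_iff order_trans[of _ 0])
    have "(LINT \<omega>|M. F (u + \<xi> \<omega>)) = (LINT \<omega>|M. G (u + V \<omega>))" for u
      using mvn_integral_decomposition[OF \<open>prob_space M\<close> xi a1 c_def, of "\<lambda>x. F (u + x)" 1] bd
      by (simp add: std G_def V_def add_ac)
    then show ?thesis using less.hyps[OF card V G Gm G1] by simp
  qed
qed

lemma mvn_centered_symmetric:
  assumes "prob_space M" "multivariate_normal M \<xi> 0 R"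
  shows "distr M borel (\<lambda>\<omega>. - \<xi> \<omega>) = distr M borel \<xi>"
proof (rule mvn_law_eqI[OF assms(1) _ assms])
  have [measurable]: "\<xi> \<in> borel_measurable M" using assms by (simp add: multivariate_normal_def)
  have *: "a \<bullet> - x = (- a) \<bullet> x" "(- a) \<bullet> (R *v (- a)) = a \<bullet> (R *v a)" for a x :: "real^'b"
    using matrix_vector_mult_diff_distrib[of R 0 a] by auto
  have "distr M borel (\<lambda>\<omega>. (- a) \<bullet> \<xi> \<omega>) = normal_law ((- a) \<bullet> 0) ((- a) \<bullet> (R *v (- a)))" for a
    using assms(2) unfolding multivariate_normal_def by blast
  then show "multivariate_normal M (\<lambda>\<omega>. - \<xi> \<omega>) 0 R"
    using assms(2) unfolding multivariate_normal_def * by simp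
qed

text \<open>The probability is an even log-concave function of the translation.\<close>

theorem anderson_gaussian:
  fixes R :: "real^'p^'p"
  assumes M: "prob_space M" and xi: "multivariate_normal M \<xi> 0 R"
    and K: "convex K" "\<And>x. x \<in> K \<Longrightarrow> - x \<in> K" "K \<in> sets borel" and s: "0 \<le> s" "s \<le> 1"
  shows "measure M {\<omega> \<in> space M. u + \<xi> \<omega> \<in> K} \<le> measure M {\<omega> \<in> space M. s *\<^sub>R u + \<xi> \<omega> \<in> K}"
proof -
  interpret M: prob_space M by fact
  have [measurable]: "\<xi> \<in> borel_measurable M" "K \<in> sets borel"
    using xi K by (auto simp: multivariate_normal_def)
  define G where "G u = (LINT \<omega>|M. indicator K (u + \<xi> \<omega>) :: real)" for u
  have G_eq: "G u = measure M {\<omega> \<in> space M. u + \<xi> \<omega> \<in> K}" for u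
  proof -
    have "G u = (LINT \<omega>|M. indicator {\<omega> \<in> space M. u + \<xi> \<omega> \<in> K} \<omega>)"
      unfolding G_def by (intro Bochner_Integration.integral_cong) (auto simp: indicator_def)
    then show ?thesis by simp
  qed
  have lc: "log_concave G"
    unfolding G_def[abs_def] using K
    by (intro mvn_translation_log_concave[OF M xi] log_concave_indicator) (auto simp: indicator_def)
  have even: "G (- u) = G u" for u
  proof -
    have "K = {x. - x \<in> K}" using K(2) by force
    then have flip: "indicator K (- x) = (indicator K x :: real)" for x by (auto simp: indicator_def)
    have "G (- u) = (LINT \<omega>|M. indicator K (u + - \<xi> \<omega>))"
    proof -
      have "indicator K (- u + x) = (indicator K (u + - x) :: real)" for x
        using flip[of "u + - x"] by simp
      then show ?thesis by (simp only: G_def)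
    qed
    also have "\<dots> = (LINT x|distr M borel (\<lambda>\<omega>. - \<xi> \<omega>). indicator K (u + x))"
      by (simp add: integral_distr)
    also have "\<dots> = G u" unfolding mvn_centered_symmetric[OF M xi] G_def by (simp add: integral_distr)
    finally show ?thesis .
  qed
  show ?thesis using log_concave_even_le[OF lc even s] by (simp add: G_eq)
qed

section \<open>The shifted normal tail beyond the rejection threshold\<close>

lemma std_normal_density_pos: "0 < std_normal_density x"
  by (simp add: std_normal_density_def)

lemma std_normal_tail_deriv:
  "(std_normal_tail has_real_derivative - std_normal_density t) (at t)"
proof -
  interpret N: real_distribution std_normal_distribution by (rule real_dist_normal_dist)
  have "\<exists>F. \<forall>x. - \<infinity> < ereal x \<longrightarrow> ereal x < \<infinity> \<longrightarrow> (F has_vector_derivative std_normal_density x) (at x)"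
    by (rule einterval_antiderivative) (auto simp: std_normal_density_def intro!: continuous_intros)
  then obtain F where F: "(F has_real_derivative std_normal_density x) (at x)" for x
    by (auto simp: has_real_derivative_iff_has_vector_derivative)
  have step: "std_normal_tail b - std_normal_tail a = F a - F b" if "a \<le> b" for a b
  proof -
    have Fab: "F a \<le> F b"
      using that
    proof (rule DERIV_nonneg_imp_nondecreasing)
      show "\<exists>y. (F has_real_derivative y) (at x) \<and> 0 \<le> y" for x
        using F[of x] by (intro exI[of _ "std_normal_density x"]) simp
    qed
    have "emeasure std_normal_distribution {a<..b}
        = (\<integral>\<^sup>+x. ennreal (std_normal_density x) * indicator {a<..b} x \<partial>lborel)"
      by (simp add: emeasure_density)
    also have "\<dots> = (\<integral>\<^sup>+x. ennreal (std_normal_density x) * indicator {a..b} x \<partial>lborel)"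
    proof (rule nn_integral_cong_AE)
      show "AE x in lborel. ennreal (std_normal_density x) * indicator {a<..b} x
          = ennreal (std_normal_density x) * indicator {a..b} x"
        using AE_lborel_singleton[of a] by eventually_elim (auto simp: indicator_def)
    qed
    also have "\<dots> = ennreal (F b - F a)"
      using that F by (intro nn_integral_FTC_Icc) auto
    finally have "measure std_normal_distribution {a<..b} = F b - F a"
      using Fab by (simp add: measure_def)
    moreover have "cdf std_normal_distribution b - cdf std_normal_distribution a
        = measure std_normal_distribution {a<..b}"
      using that N.cdf_diff_eq[of a b] by (cases "a = b") auto
    ultimately show ?thesis by (simp add: std_normal_tail_def std_normal_cdf_def)
  qed
  have "std_normal_tail x = std_normal_tail 0 + F 0 - F x" for x
    using step[of 0 x] step[of x 0] by (cases "0 \<le> x") auto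
  then have "std_normal_tail = (\<lambda>x. std_normal_tail 0 + F 0 - F x)" by (rule ext)
  moreover have "((\<lambda>x. std_normal_tail 0 + F 0 - F x) has_real_derivative - std_normal_density t) (at t)"
    using F by (auto intro!: derivative_eq_intros)
  ultimately show ?thesis by (simp only:)
qed

lemma std_normal_tail_less_iff: "std_normal_tail x < std_normal_tail y \<longleftrightarrow> y < x"
proof -
  have *: "std_normal_tail b < std_normal_tail a" if "a < b" for a b
    using that
  proof (rule DERIV_neg_imp_decreasing)
    show "\<exists>y. (std_normal_tail has_real_derivative y) (at x) \<and> y < 0" for x
      using std_normal_tail_deriv[of x] std_normal_density_pos[of x]
      by (intro exI[of _ "- std_normal_density x"]) simp
  qed
  show ?thesis using *[of x y] *[of y x] by (cases x y rule: linorder_cases) auto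
qed

lemma std_normal_tail_le_iff: "std_normal_tail x \<le> std_normal_tail y \<longleftrightarrow> y \<le> x"
  using std_normal_tail_less_iff[of y x] by linarith

lemma inj_std_normal_tail: "inj std_normal_tail"
  by (rule injI) (metis std_normal_tail_le_iff order_antisym order_refl)

lemma isCont_std_normal_tail: "isCont std_normal_tail t"
  using std_normal_tail_deriv by (rule DERIV_isCont)

lemma std_normal_tail_at_top: "(std_normal_tail \<longlongrightarrow> 0) at_top"
proof -
  interpret N: real_distribution std_normal_distribution by (rule real_dist_normal_dist)
  have "((\<lambda>x. 1 - cdf std_normal_distribution x) \<longlongrightarrow> 1 - 1) at_top"
    by (intro tendsto_intros N.cdf_lim_at_top_prob)
  then show ?thesis by (simp add: std_normal_tail_def[abs_def] std_normal_cdf_def)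
qed

lemma std_normal_tail_at_bot: "(std_normal_tail \<longlongrightarrow> 1) at_bot"
proof -
  interpret N: real_distribution std_normal_distribution by (rule real_dist_normal_dist)
  have "((\<lambda>x. 1 - cdf std_normal_distribution x) \<longlongrightarrow> 1 - 0) at_bot"
    by (intro tendsto_intros N.cdf_lim_at_bot)
  then show ?thesis by (simp add: std_normal_tail_def[abs_def] std_normal_cdf_def)
qed

lemma std_normal_tail_pos: "0 < std_normal_tail t"
proof -
  have "0 \<le> std_normal_tail (t + 1)"
  proof -
    interpret N: real_distribution std_normal_distribution by (rule real_dist_normal_dist)
    show ?thesis using N.cdf_bounded_prob[of "t + 1"] by (simp add: std_normal_tail_def std_normal_cdf_def)
  qed
  also have "\<dots> < std_normal_tail t" by (simp add: std_normal_tail_less_iff)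
  finally show ?thesis .
qed

lemma std_normal_tail_less_1: "std_normal_tail t < 1"
proof -
  have "std_normal_tail t < std_normal_tail (t - 1)" by (simp add: std_normal_tail_less_iff)
  also have "\<dots> \<le> 1"
  proof -
    interpret N: real_distribution std_normal_distribution by (rule real_dist_normal_dist)
    show ?thesis using N.cdf_nonneg[of "t - 1"] by (simp add: std_normal_tail_def std_normal_cdf_def)
  qed
  finally show ?thesis .
qed

lemma std_normal_tail_surj:
  assumes "0 < y" "y < 1"
  shows "\<exists>x. std_normal_tail x = y"
proof -
  have "\<forall>\<^sub>F x in at_top. std_normal_tail x < y" using std_normal_tail_at_top assms(1) by (rule order_tendstoD)
  then obtain b where b: "std_normal_tail b < y" by (meson eventually_at_top_linorder order_refl)
  have "\<forall>\<^sub>F x in at_bot. y < std_normal_tail x" using std_normal_tail_at_bot assms(2) by (rule order_tendstoD)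
  then obtain a where a: "y < std_normal_tail a" by (meson eventually_at_bot_linorder order_refl)
  have "a \<le> b" using a b std_normal_tail_less_iff[of b a] by simp
  then have "\<exists>x. a \<le> x \<and> x \<le> b \<and> std_normal_tail x = y"
    using a b isCont_std_normal_tail by (intro IVT2) auto
  then show ?thesis by auto
qed

text \<open>The likelihood ratio between \<open>N(m, 1)\<close> and \<open>N(0, 1)\<close>.\<close>

lemma std_normal_density_shift:
  "std_normal_density (x - m) = std_normal_density x * exp (m * x - m\<^sup>2 / 2)"
  by (simp add: std_normal_density_def field_simps power2_eq_square flip: exp_add)

lemma normal_law_1: "normal_law m 1 = density lborel (\<lambda>x. ennreal (std_normal_density (x - m)))"
  by (simp add: normal_law_def normal_density_def std_normal_density_def)

lemma integral_normal_law_1: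
  assumes "f \<in> borel_measurable borel"
  shows "(LINT t|normal_law m 1. f t) = (LINT t|lborel. std_normal_density (t - m) * f t)"
  unfolding normal_law_1 using assms by (subst integral_density) auto

lemma integral_Ici_FTC:
  fixes f :: "real \<Rightarrow> real"
  assumes "f \<in> borel_measurable borel" "\<And>x. a \<le> x \<Longrightarrow> DERIV F x :> f x"
    "\<And>x. a \<le> x \<Longrightarrow> 0 \<le> f x" "(F \<longlongrightarrow> 0) at_top" "F a \<le> 0"
  shows "has_bochner_integral lborel (\<lambda>x. f x * indicator {a..} x) (- F a)"
proof (rule has_bochner_integral_nn_integral)
  have "(\<integral>\<^sup>+x. ennreal (f x * indicator {a..} x) \<partial>lborel) = (\<integral>\<^sup>+x. ennreal (f x) * indicator {a..} x \<partial>lborel)"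
    by (intro nn_integral_cong) (auto simp: indicator_def)
  then show "(\<integral>\<^sup>+x. ennreal (f x * indicator {a..} x) \<partial>lborel) = ennreal (- F a)"
    using nn_integral_FTC_atLeast[OF assms(1-4)] by simp
qed (use assms in \<open>auto simp: indicator_def\<close>)

lemma has_integral_normal_tail:
  "has_bochner_integral lborel (\<lambda>x. std_normal_density (x - m) * indicator {a..} x) (std_normal_tail (a - m))"
proof -
  have "has_bochner_integral lborel (\<lambda>x. std_normal_density (x - m) * indicator {a..} x)
     (- (- std_normal_tail (a - m)))"
  proof (rule integral_Ici_FTC)
    show "((\<lambda>x. - std_normal_tail (x - m)) has_real_derivative std_normal_density (x - m)) (at x)" for x
      using DERIV_shift[of std_normal_tail "- std_normal_density (x - m)" x "- m"] std_normal_tail_deriv[of "x - m"]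
      by (auto intro!: derivative_eq_intros)
    have "((\<lambda>x. - std_normal_tail (x - m)) \<longlongrightarrow> - 0) at_top"
      by (intro tendsto_minus filterlim_compose[OF std_normal_tail_at_top]) real_asymp
    then show "((\<lambda>x. - std_normal_tail (x - m)) \<longlongrightarrow> 0) at_top" by simp
  qed (use std_normal_tail_pos[of "a - m"] in auto)
  then show ?thesis by simp
qed

text \<open>The smallest value of the first knot at which the test of level \<open>\<alpha>\<close> rejects when the second knot
  is \<open>t\<close>.\<close>

definition rejection_threshold :: "real \<Rightarrow> real \<Rightarrow> real" where
  "rejection_threshold \<alpha> t = inv std_normal_tail (\<alpha> * std_normal_tail t)"

context
  fixes \<alpha> :: real
  assumes \<alpha>: "0 < \<alpha>" "\<alpha> < 1"
begin

lemma tail_rejection_threshold: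
  "std_normal_tail (rejection_threshold \<alpha> t) = \<alpha> * std_normal_tail t"
proof -
  have "\<alpha> * std_normal_tail t < 1 * 1"
    using \<alpha> std_normal_tail_pos[of t] std_normal_tail_less_1[of t] by (intro mult_strict_mono) auto
  then obtain x where "std_normal_tail x = \<alpha> * std_normal_tail t"
    using std_normal_tail_surj[of "\<alpha> * std_normal_tail t"] \<alpha> std_normal_tail_pos[of t] by auto
  then have "\<alpha> * std_normal_tail t \<in> range std_normal_tail" by (metis rangeI)
  then show ?thesis unfolding rejection_threshold_def by (rule f_inv_into_f)
qed

lemma rejection_threshold_le_iff:
  "rejection_threshold \<alpha> t \<le> x \<longleftrightarrow> std_normal_tail x \<le> \<alpha> * std_normal_tail t"
  by (simp only: tail_rejection_threshold[symmetric] std_normal_tail_le_iff)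

lemma rejection_threshold_gt: "t < rejection_threshold \<alpha> t"
proof -
  have "std_normal_tail (rejection_threshold \<alpha> t) < std_normal_tail t"
    unfolding tail_rejection_threshold using \<alpha> std_normal_tail_pos[of t] by simp
  then show ?thesis by (simp only: std_normal_tail_less_iff)
qed

lemma rejection_threshold_deriv:
  "(rejection_threshold \<alpha> has_real_derivative
     \<alpha> * std_normal_density t / std_normal_density (rejection_threshold \<alpha> t)) (at t)"
proof -
  let ?g = "rejection_threshold \<alpha> t"
  have "isCont (inv std_normal_tail) (std_normal_tail ?g)"
    by (rule isCont_inverse_function[of 1])
      (auto simp: inv_f_f inj_std_normal_tail isCont_std_normal_tail)
  then have cont: "isCont (inv std_normal_tail) (\<alpha> * std_normal_tail t)"
    by (simp add: tail_rejection_threshold)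
  have y: "0 < \<alpha> * std_normal_tail t" "\<alpha> * std_normal_tail t < 1"
    using std_normal_tail_pos[of ?g] std_normal_tail_less_1[of ?g] by (simp_all add: tail_rejection_threshold)
  have "(inv std_normal_tail has_real_derivative inverse (- std_normal_density ?g)) (at (\<alpha> * std_normal_tail t))"
  proof (rule DERIV_inverse_function[OF _ _ y _ cont])
    show "(std_normal_tail has_real_derivative - std_normal_density ?g)
        (at (inv std_normal_tail (\<alpha> * std_normal_tail t)))"
      using std_normal_tail_deriv[of ?g] by (simp add: rejection_threshold_def)
    show "- std_normal_density ?g \<noteq> 0" using std_normal_density_pos[of ?g] by simp
    show "std_normal_tail (inv std_normal_tail y) = y" if "0 < y" "y < 1" for y
      using std_normal_tail_surj[OF that] by (metis f_inv_into_f rangeI)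
  qed
  moreover have "((\<lambda>t. \<alpha> * std_normal_tail t) has_real_derivative \<alpha> * (- std_normal_density t)) (at t)"
    by (intro DERIV_cmult std_normal_tail_deriv)
  ultimately have "((\<lambda>t. inv std_normal_tail (\<alpha> * std_normal_tail t)) has_real_derivative
      inverse (- std_normal_density ?g) * (\<alpha> * (- std_normal_density t))) (at t)"
    by (rule DERIV_chain2)
  then show ?thesis
    by (simp add: rejection_threshold_def[abs_def] field_simps)
qed

lemma isCont_rejection_threshold: "isCont (rejection_threshold \<alpha>) t"
  using rejection_threshold_deriv by (rule DERIV_isCont)

lemma rejection_threshold_measurable [measurable]: "rejection_threshold \<alpha> \<in> borel_measurable borel"
  by (intro borel_measurable_continuous_onI continuous_at_imp_continuous_on ballI isCont_rejection_threshold)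

text \<open>With \<open>c\<close> the bound, \<open>exp (- c\<^sup>2 / 2) = \<alpha>\<close>, and for nonnegative arguments shifting the
  density by \<open>c\<close> shrinks it at least by this factor; hence \<open>T (t + c) \<le> \<alpha> * T t\<close> for the normal
  tail \<open>T\<close>. The bound keeps all integrals in the sequel finite.\<close>

lemma rejection_threshold_gap_bounded:
  assumes "0 \<le> t"
  shows "rejection_threshold \<alpha> t - t \<le> sqrt (2 * ln (1 / \<alpha>))"
proof -
  define c where "c = sqrt (2 * ln (1 / \<alpha>))"
  have "0 \<le> ln (1 / \<alpha>)" using \<alpha> by simp
  then have c: "0 \<le> c" "c\<^sup>2 = 2 * ln (1 / \<alpha>)" by (simp_all add: c_def)
  then have ec: "exp (- c\<^sup>2 / 2) = \<alpha>" using \<alpha> by (simp add: ln_div)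
  define D where "D t = \<alpha> * std_normal_tail t - std_normal_tail (t + c)" for t
  have deriv: "(D has_real_derivative - \<alpha> * std_normal_density x + std_normal_density (x + c)) (at x)" for x
  proof -
    have "((\<lambda>x. std_normal_tail (x + c)) has_real_derivative - std_normal_density (x + c)) (at x)"
      using std_normal_tail_deriv[of "x + c"] by (simp add: DERIV_shift)
    from DERIV_diff[OF DERIV_cmult[OF std_normal_tail_deriv[of x], of \<alpha>] this]
    show ?thesis by (simp add: D_def[abs_def])
  qed
  have neg: "- \<alpha> * std_normal_density x + std_normal_density (x + c) \<le> 0" if "0 \<le> x" for x
  proof -
    have "std_normal_density (x + c) = std_normal_density x * (exp (- (c * x)) * \<alpha>)"
    proof -
      have "std_normal_density (x - - c) = std_normal_density x * (exp (- (c * x)) * exp (- c\<^sup>2 / 2))"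
        unfolding std_normal_density_shift by (simp flip: exp_add)
      then show ?thesis by (simp only: ec) simp
    qed
    also have "\<dots> \<le> std_normal_density x * (1 * \<alpha>)"
      using that c \<alpha> by (intro mult_left_mono mult_right_mono) auto
    finally show ?thesis by (simp add: mult.commute)
  qed
  \<comment> \<open>\<open>D\<close> decreases to its limit \<open>0\<close>, so it is nonnegative.\<close>
  have mono: "D y \<le> D t" if "t \<le> y" for y
    using that
  proof (rule DERIV_nonpos_imp_nonincreasing)
    fix x assume "t \<le> x"
    then show "\<exists>y. (D has_real_derivative y) (at x) \<and> y \<le> 0"
      using deriv[of x] neg[of x] assms by (meson order_trans)
  qed
  have "LIM x at_top. x + c :> at_top" by real_asymp
  then have "(D \<longlongrightarrow> \<alpha> * 0 - 0) at_top"
    unfolding D_def by (intro tendsto_intros std_normal_tail_at_top filterlim_compose[OF std_normal_tail_at_top])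
  moreover have "\<forall>\<^sub>F y in at_top. D y \<le> D t"
    using eventually_ge_at_top[of t] by eventually_elim (rule mono)
  ultimately have "\<alpha> * 0 - 0 \<le> D t" by (intro tendsto_upperbound[of D _ at_top]) auto
  then have "rejection_threshold \<alpha> t \<le> t + c"
    by (simp add: rejection_threshold_le_iff D_def)
  then show ?thesis by (simp add: c_def)
qed

text \<open>Under the null hypothesis (\<open>m = 0\<close>) this says that, given that the leading coordinate exceeds
  \<open>l\<close>, it exceeds the threshold with probability \<open>\<alpha>\<close>. In general, the substitution by the threshold turns the
  likelihood ratio at \<open>t\<close> into the one at the threshold of \<open>t\<close>.\<close>

lemma has_integral_tail_at_threshold:
  "has_bochner_integral lborel
     (\<lambda>t. \<alpha> * std_normal_density t * exp (m * rejection_threshold \<alpha> t - m\<^sup>2 / 2) * indicator {l..} t)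
     (std_normal_tail (rejection_threshold \<alpha> l - m))"
proof -
  let ?g = "rejection_threshold \<alpha>"
  have "has_bochner_integral lborel
     (\<lambda>t. \<alpha> * std_normal_density t * exp (m * ?g t - m\<^sup>2 / 2) * indicator {l..} t)
     (- (- std_normal_tail (?g l - m)))"
  proof (rule integral_Ici_FTC)
    fix t
    have gd: "((\<lambda>t. ?g t - m) has_real_derivative \<alpha> * std_normal_density t / std_normal_density (?g t)) (at t)"
      using rejection_threshold_deriv by (auto intro!: derivative_eq_intros)
    have "((\<lambda>t. - std_normal_tail (?g t - m)) has_real_derivative
        - (- std_normal_density (?g t - m) * (\<alpha> * std_normal_density t / std_normal_density (?g t)))) (at t)"
      by (intro DERIV_minus DERIV_chain2[OF std_normal_tail_deriv gd])
    moreover have "- (- std_normal_density (?g t - m) * (\<alpha> * std_normal_density t / std_normal_density (?g t)))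
        = \<alpha> * std_normal_density t * exp (m * ?g t - m\<^sup>2 / 2)"
      unfolding std_normal_density_shift using std_normal_density_pos[of "?g t"] by (simp add: field_simps)
    ultimately show "((\<lambda>t. - std_normal_tail (?g t - m)) has_real_derivative
        \<alpha> * std_normal_density t * exp (m * ?g t - m\<^sup>2 / 2)) (at t)" by simp
    show "0 \<le> \<alpha> * std_normal_density t * exp (m * ?g t - m\<^sup>2 / 2)" using \<alpha> by simp
  next
    have "LIM t at_top. ?g t - m :> at_top"
    proof (rule filterlim_at_top_mono)
      show "LIM t at_top. t - m :> at_top" by real_asymp
      show "\<forall>\<^sub>F t in at_top. t - m \<le> ?g t - m"
        by (intro always_eventually allI) (simp add: less_imp_le rejection_threshold_gt)
    qed
    then have "((\<lambda>t. - std_normal_tail (?g t - m)) \<longlongrightarrow> - 0) at_top"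
      by (intro tendsto_minus filterlim_compose[OF std_normal_tail_at_top])
    then show "((\<lambda>t. - std_normal_tail (?g t - m)) \<longlongrightarrow> 0) at_top" by simp
  qed (use std_normal_tail_pos[of "?g l - m"] in auto)
  then show ?thesis by simp
qed

text \<open>The conditional power given the residual, where \<open>l\<close> is the second knot. The rejection probability
  exceeds its share of the level at least by a drift term that has the sign of \<open>m\<close>; only the sum of
  these terms over all signed indices will be controlled.\<close>

lemma shifted_rejection_lower_bound:
  assumes l: "0 \<le> l"
  shows "0 \<le> (LINT t|normal_law m 1. indicator {l..} t *
      (of_bool (std_normal_tail t \<le> \<alpha> * std_normal_tail l) - \<alpha> - \<alpha> * m * (rejection_threshold \<alpha> t - t)))"
proof -
  let ?g = "rejection_threshold \<alpha>" and ?\<phi> = "\<lambda>t. std_normal_density (t - m)"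
  note I1 = has_integral_normal_tail[of m "?g l"] and I2 = has_integral_tail_at_threshold[of m l]
  let ?d = "\<lambda>t. ?\<phi> t * indicator {?g l..} t
      - \<alpha> * std_normal_density t * exp (m * ?g t - m\<^sup>2 / 2) * indicator {l..} t"
  have d0: "has_bochner_integral lborel ?d 0"
    using has_bochner_integral_diff[OF I1 I2] by simp
  have meas: "(\<lambda>t. indicator {l..} t * (of_bool (std_normal_tail t \<le> \<alpha> * std_normal_tail l) - \<alpha>
      - \<alpha> * m * (?g t - t)) :: real) \<in> borel_measurable borel"
    unfolding rejection_threshold_le_iff[symmetric] by measurable
  let ?f = "\<lambda>t. ?\<phi> t * (indicator {l..} t * (of_bool (std_normal_tail t \<le> \<alpha> * std_normal_tail l) - \<alpha>
      - \<alpha> * m * (?g t - t)))"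
  have le: "?d t \<le> ?f t" for t
  proof (cases "l \<le> t")
    case True
    \<comment> \<open>This is where the drift term comes from: the likelihood ratio is linearized.\<close>
    have "?\<phi> t * (1 + m * (?g t - t)) \<le> ?\<phi> t * exp (m * (?g t - t))"
      by (intro mult_left_mono exp_ge_add_one_self) auto
    also have "\<dots> = std_normal_density t * exp (m * ?g t - m\<^sup>2 / 2)"
      unfolding std_normal_density_shift by (simp add: algebra_simps flip: exp_add)
    finally have "\<alpha> * (?\<phi> t * (1 + m * (?g t - t))) \<le> \<alpha> * (std_normal_density t * exp (m * ?g t - m\<^sup>2 / 2))"
      using \<alpha> by simp
    then show ?thesis using True
      by (simp add: rejection_threshold_le_iff[symmetric] indicator_def algebra_simps)
  next
    case False
    then have "\<not> ?g l \<le> t" using rejection_threshold_gt[of l] by linarith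
    then show ?thesis using False by simp
  qed
  have int: "integrable lborel ?f"
  proof (rule Bochner_Integration.integrable_bound)
    let ?C = "1 + \<alpha> + \<alpha> * \<bar>m\<bar> * sqrt (2 * ln (1 / \<alpha>))"
    show "integrable lborel (\<lambda>t. ?C * (?\<phi> t * indicator {l..} t))"
      using has_integral_normal_tail[of m l] by (intro integrable_mult_right) (auto simp: has_bochner_integral_iff)
    have bd: "norm (of_bool b - \<alpha> - \<alpha> * m * (?g t - t)) \<le> ?C" if "l \<le> t" for t b
    proof -
      have "0 \<le> ?g t - t" "?g t - t \<le> sqrt (2 * ln (1 / \<alpha>))"
        using rejection_threshold_gt[of t] rejection_threshold_gap_bounded[of t] that l by auto
      then have "\<bar>\<alpha> * m * (?g t - t)\<bar> \<le> \<alpha> * \<bar>m\<bar> * sqrt (2 * ln (1 / \<alpha>))"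
        using \<alpha> by (simp add: abs_mult mult_left_mono)
      moreover have "norm (of_bool b - \<alpha> - X) \<le> 1 + \<alpha> + \<bar>X\<bar>" for X :: real
        using \<alpha> by (cases b) auto
      ultimately show ?thesis by (meson add_left_mono order_trans)
    qed
    have C0: "0 \<le> ?C" using bd[OF order_refl, of True] by (rule order_trans[OF norm_ge_zero])
    have "norm (?f t) \<le> norm (?C * (?\<phi> t * indicator {l..} t))" for t
    proof (cases "l \<le> t")
      case True
      then have "norm (?f t) = ?\<phi> t * norm (of_bool (std_normal_tail t \<le> \<alpha> * std_normal_tail l) - \<alpha> - \<alpha> * m * (?g t - t))"
        by (simp only: norm_mult) simp
      also have "\<dots> \<le> ?\<phi> t * ?C" by (intro mult_left_mono bd True) simp
      also have "\<dots> = norm (?C * (?\<phi> t * indicator {l..} t))"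
        using True C0 by (simp only: norm_mult) simp
      finally show ?thesis .
    qed simp
    then show "AE t in lborel. norm (?f t) \<le> norm (?C * (?\<phi> t * indicator {l..} t))" by simp
    show "?f \<in> borel_measurable lborel" using meas by measurable
  qed
  have "0 = (LINT t|lborel. ?d t)" using d0 by (simp add: has_bochner_integral_iff)
  also have "\<dots> \<le> (LINT t|lborel. ?f t)"
    using d0 int le by (intro integral_mono) (auto simp: has_bochner_integral_iff)
  also have "\<dots> = (LINT t|normal_law m 1. indicator {l..} t *
      (of_bool (std_normal_tail t \<le> \<alpha> * std_normal_tail l) - \<alpha> - \<alpha> * m * (?g t - t)))"
    by (rule integral_normal_law_1[OF meas, symmetric])
  finally show ?thesis .
qed

end

section \<open>Drift of the sup norm along the mean\<close>

lemma integrable_normal_law_ident: "0 \<le> v \<Longrightarrow> integrable (normal_law m v) (\<lambda>x. x)"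
proof -
  assume v: "0 \<le> v"
  interpret real_distribution std_normal_distribution by (rule real_dist_normal_dist)
  have "integrable std_normal_distribution (\<lambda>z. m + sqrt v * z)"
    using integrable_std_normal_distribution_moment[of 1] by simp
  then show ?thesis unfolding normal_law_affine[OF v] by (subst integrable_distr_eq) auto
qed

lemma mvn_integrable_coordinate:
  assumes U: "multivariate_normal M U \<mu> R"
  shows "integrable M (\<lambda>\<omega>. U \<omega> $ i)"
proof -
  have [measurable]: "U \<in> borel_measurable M" by (rule mvn_measurable[OF U])
  have "0 \<le> R $ i $ i" using U covariance_diagonal_nonneg by (auto simp: multivariate_normal_def)
  then have "integrable (distr M borel (\<lambda>\<omega>. U \<omega> $ i)) (\<lambda>x. x)"
    unfolding mvn_coordinate_law[OF U] by (rule integrable_normal_law_ident)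
  then show ?thesis by (subst (asm) integrable_distr_eq) auto
qed

lemma infnorm_eq_Max_cart: "infnorm (x::real^'n) = Max (range (\<lambda>i. \<bar>x $ i\<bar>))"
proof -
  have "{\<bar>x $ i\<bar> |i. i \<in> UNIV} = range (\<lambda>i. \<bar>x $ i\<bar>)" by auto
  then show ?thesis unfolding infnorm_cart by (simp add: cSup_eq_Max)
qed

lemma infnorm_le_iff_cart: "infnorm (x::real^'n) \<le> s \<longleftrightarrow> (\<forall>i. \<bar>x $ i\<bar> \<le> s)"
  unfolding infnorm_eq_Max_cart by (subst Max_le_iff) auto

lemma infnorm_attained: "\<exists>i. infnorm (x::real^'n) = \<bar>x $ i\<bar>"
proof -
  have "Max (range (\<lambda>i. \<bar>x $ i\<bar>)) \<in> range (\<lambda>i. \<bar>x $ i\<bar>)" by (rule Max_in) auto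
  then show ?thesis unfolding infnorm_eq_Max_cart by blast
qed

lemma borel_measurable_infnorm [measurable (raw)]:
  "f \<in> borel_measurable M \<Longrightarrow> (\<lambda>\<omega>. infnorm (f \<omega>)) \<in> borel_measurable M"
  by (rule borel_measurable_continuous_on[where f = infnorm]) (auto intro: continuous_intros continuous_at_imp_continuous_on)

text \<open>Anderson's inequality for the cube.\<close>

lemma infnorm_translate_stochastic_mono:
  fixes \<mu> :: "real^'p"
  assumes M: "prob_space M" and xi: "multivariate_normal M \<xi> 0 R" and s: "0 \<le> s" "s \<le> 1"
  shows "measure M {\<omega> \<in> space M. x < infnorm (s *\<^sub>R \<mu> + \<xi> \<omega>)} \<le> measure M {\<omega> \<in> space M. x < infnorm (\<mu> + \<xi> \<omega>)}"
proof -
  interpret M: prob_space M by fact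
  have [measurable]: "\<xi> \<in> borel_measurable M" by (rule mvn_measurable[OF xi])
  let ?K = "{y::real^'p. infnorm y \<le> x}"
  have K: "?K \<in> sets borel" by measurable
  have conv: "convex ?K"
  proof (rule convexI)
    fix y z and a b :: real
    assume yz: "y \<in> ?K" "z \<in> ?K" and ab: "0 \<le> a" "0 \<le> b" "a + b = 1"
    have "infnorm (a *\<^sub>R y + b *\<^sub>R z) \<le> a * infnorm y + b * infnorm z"
      using infnorm_triangle[of "a *\<^sub>R y" "b *\<^sub>R z"] ab by (simp add: infnorm_mul)
    also have "\<dots> \<le> a * x + b * x" using yz ab by (intro add_mono mult_left_mono) auto
    also have "\<dots> = x" using ab by (simp flip: distrib_right)
    finally show "a *\<^sub>R y + b *\<^sub>R z \<in> ?K" by simp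
  qed
  have compl: "measure M {\<omega> \<in> space M. x < infnorm (v + \<xi> \<omega>)} = 1 - measure M {\<omega> \<in> space M. v + \<xi> \<omega> \<in> ?K}" for v
  proof -
    have "{\<omega> \<in> space M. x < infnorm (v + \<xi> \<omega>)} = space M - {\<omega> \<in> space M. v + \<xi> \<omega> \<in> ?K}" by auto
    then show ?thesis by (simp only:) (rule M.prob_compl, measurable)
  qed
  show ?thesis unfolding compl
    using anderson_gaussian[OF M xi conv _ K s, of \<mu>] by (simp add: infnorm_neg)
qed

text \<open>The hypothesis on \<open>D\<close> holds for a subgradient of the sup norm at \<open>\<mu> + \<xi> \<omega>\<close> paired with
  \<open>\<mu>\<close>. With an increasing antiderivative \<open>W\<close> of \<open>w\<close> and
  \<open>N\<close> the norm, the differences \<open>W N - W (N - h * D)\<close> dominate those of \<open>W\<close> of the norm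
  between the means \<open>\<mu>\<close> and \<open>(1 - h) *\<^sub>R \<mu>\<close>, whose expectation is nonnegative by Anderson's inequality.
  Dividing by \<open>h\<close> and letting \<open>h\<close> tend to \<open>0\<close> gives the claim.\<close>

lemma infnorm_directional_moment_nonneg:
  fixes \<mu> :: "real^'p"
  assumes M: "prob_space M" and xi: "multivariate_normal M \<xi> 0 R"
    and w: "\<And>t. isCont w t" "\<And>t. 0 \<le> w t" "\<And>t. w t \<le> C"
    and D [measurable]: "D \<in> borel_measurable M" and DB: "\<And>\<omega>. \<bar>D \<omega>\<bar> \<le> B"
    and dir: "\<And>\<omega> h. 0 \<le> h \<Longrightarrow> infnorm (\<mu> + \<xi> \<omega>) - h * D \<omega> \<le> infnorm ((1 - h) *\<^sub>R \<mu> + \<xi> \<omega>)"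
  shows "0 \<le> (LINT \<omega>|M. D \<omega> * w (infnorm (\<mu> + \<xi> \<omega>)))"
proof -
  interpret M: prob_space M by fact
  have [measurable]: "\<xi> \<in> borel_measurable M" by (rule mvn_measurable[OF xi])
  have wm [measurable]: "w \<in> borel_measurable borel"
    using w(1) by (intro borel_measurable_continuous_onI continuous_at_imp_continuous_on ballI)
  have C: "0 \<le> C" using w(2,3)[of 0] by (rule order_trans)
  have "\<exists>F. \<forall>x. - \<infinity> < ereal x \<longrightarrow> ereal x < \<infinity> \<longrightarrow> (F has_vector_derivative w x) (at x)"
    by (rule einterval_antiderivative) (auto intro: w)
  then obtain F0 where F0: "(F0 has_real_derivative w x) (at x)" for x
    by (auto simp: has_real_derivative_iff_has_vector_derivative)
  define W where "W x = F0 x - F0 0" for x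
  have Wd: "(W has_real_derivative w x) (at x)" for x
    unfolding W_def using F0 by (auto intro!: derivative_eq_intros)
  have W0: "W 0 = 0" by (simp add: W_def)
  have Wmono: "W x \<le> W y" if "x \<le> y" for x y
    using that by (rule DERIV_nonneg_imp_nondecreasing) (use Wd w(2) in blast)
  have Wlip: "\<bar>W y - W x\<bar> \<le> C * \<bar>y - x\<bar>" for x y
  proof -
    have *: "W y - W x \<le> C * (y - x)" if xy: "x \<le> y" for x y
    proof (cases "x = y")
      case False
      then obtain z where "W y - W x = (y - x) * w z"
        using MVT2[of x y W w] Wd xy by (metis order_le_less)
      also have "\<dots> \<le> (y - x) * C" using xy w(3) by (intro mult_left_mono) auto
      finally show ?thesis by (simp add: mult.commute)
    qed simp
    show ?thesis using *[of x y] *[of y x] Wmono[of x y] Wmono[of y x] by (cases "x \<le> y") auto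
  qed
  have Wm [measurable]: "W \<in> borel_measurable borel"
    using Wd by (intro borel_measurable_continuous_onI continuous_at_imp_continuous_on ballI) (blast intro: DERIV_isCont)
  define N where "N v \<omega> = infnorm (v + \<xi> \<omega>)" for v :: "real^'p" and \<omega>
  have [measurable]: "N v \<in> borel_measurable M" for v unfolding N_def by measurable
  have N0: "0 \<le> N v \<omega>" for v \<omega> by (simp add: N_def infnorm_pos_le)
  have intN: "integrable M (\<lambda>\<omega>. W (N v \<omega>))" for v
  proof (rule Bochner_Integration.integrable_bound)
    show "integrable M (\<lambda>\<omega>. C * (\<Sum>i\<in>UNIV. \<bar>v $ i\<bar> + \<bar>\<xi> \<omega> $ i\<bar>))"
      by (intro integrable_mult_right Bochner_Integration.integrable_sum Bochner_Integration.integrable_add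
          integrable_abs mvn_integrable_coordinate[OF xi]) auto
    have "norm (W (N v \<omega>)) \<le> norm (C * (\<Sum>i\<in>UNIV. \<bar>v $ i\<bar> + \<bar>\<xi> \<omega> $ i\<bar>))" for \<omega>
    proof -
      obtain i where "N v \<omega> = \<bar>(v + \<xi> \<omega>) $ i\<bar>" unfolding N_def using infnorm_attained by blast
      then have "N v \<omega> \<le> \<bar>v $ i\<bar> + \<bar>\<xi> \<omega> $ i\<bar>" by simp
      also have "\<dots> \<le> (\<Sum>i\<in>UNIV. \<bar>v $ i\<bar> + \<bar>\<xi> \<omega> $ i\<bar>)" by (rule member_le_sum) auto
      finally have "C * N v \<omega> \<le> C * (\<Sum>i\<in>UNIV. \<bar>v $ i\<bar> + \<bar>\<xi> \<omega> $ i\<bar>)" using C by (rule mult_left_mono)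
      then show ?thesis using Wlip[of "N v \<omega>" 0] N0[of v \<omega>] C by (auto simp: W0 intro: order_trans[OF _ abs_ge_self])
    qed
    then show "AE \<omega> in M. norm (W (N v \<omega>)) \<le> norm (C * (\<Sum>i\<in>UNIV. \<bar>v $ i\<bar> + \<bar>\<xi> \<omega> $ i\<bar>))" by simp
  qed measurable
  have layer: "(\<integral>\<^sup>+\<omega>. ennreal (W (N v \<omega>)) \<partial>M)
      = (\<integral>\<^sup>+s. ennreal (w s) * indicator {0<..} s * emeasure M {\<omega> \<in> space M. s < N v \<omega>} \<partial>lborel)" for v
  proof (rule nn_integral_layer_cake)
    fix \<omega>
    have "ennreal (W (N v \<omega>)) = ennreal (W (N v \<omega>) - W 0)" by (simp add: W0)
    also have "\<dots> = (\<integral>\<^sup>+s. ennreal (w s) * indicator {0..N v \<omega>} s \<partial>lborel)"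
      using Wd w(2) N0 by (intro nn_integral_FTC_Icc[symmetric]) auto
    also have "\<dots> = (\<integral>\<^sup>+s. ennreal (w s) * indicator {0<..<N v \<omega>} s \<partial>lborel)"
    proof (rule nn_integral_cong_AE)
      show "AE s in lborel. ennreal (w s) * indicator {0..N v \<omega>} s = ennreal (w s) * indicator {0<..<N v \<omega>} s"
        using AE_lborel_singleton[of 0] AE_lborel_singleton[of "N v \<omega>"]
        by eventually_elim (auto simp: indicator_def)
    qed
    finally show "ennreal (W (N v \<omega>)) = (\<integral>\<^sup>+s. ennreal (w s) * indicator {0<..<N v \<omega>} s \<partial>lborel)" .
  qed (auto intro: M.sigma_finite_measure_axioms)
  have dom: "(LINT \<omega>|M. W (N ((1 - h) *\<^sub>R \<mu>) \<omega>)) \<le> (LINT \<omega>|M. W (N \<mu> \<omega>))" if h: "0 \<le> h" "h \<le> 1" for h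
  proof -
    have nn: "ennreal (LINT \<omega>|M. W (N v \<omega>)) = (\<integral>\<^sup>+\<omega>. ennreal (W (N v \<omega>)) \<partial>M)" for v
      using intN[of v] Wmono[OF N0] W0 by (subst nn_integral_eq_integral) auto
    have "ennreal (LINT \<omega>|M. W (N ((1 - h) *\<^sub>R \<mu>) \<omega>)) \<le> ennreal (LINT \<omega>|M. W (N \<mu> \<omega>))"
      unfolding nn layer unfolding N_def M.emeasure_eq_measure using h
      by (intro nn_integral_mono mult_left_mono ennreal_leI infnorm_translate_stochastic_mono[OF M xi]) auto
    moreover have "0 \<le> (LINT \<omega>|M. W (N \<mu> \<omega>))"
      using Wmono[OF N0] W0 by (intro Bochner_Integration.integral_nonneg) auto
    ultimately show ?thesis by (simp add: ennreal_le_iff)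
  qed
  \<comment> \<open>Difference quotients of \<open>W\<close> with step \<open>1 / Suc n\<close>.\<close>
  define q where "q n \<omega> = (W (N \<mu> \<omega>) - W (N \<mu> \<omega> - (1 / Suc n) * D \<omega>)) * Suc n" for n \<omega>
  have qm [measurable]: "q n \<in> borel_measurable M" for n unfolding q_def by measurable
  have qb: "norm (q n \<omega>) \<le> C * B" for n \<omega>
  proof -
    have "\<bar>W (N \<mu> \<omega>) - W (N \<mu> \<omega> - (1 / Suc n) * D \<omega>)\<bar> \<le> C * \<bar>(1 / Suc n) * D \<omega>\<bar>"
      using Wlip[of "N \<mu> \<omega>" "N \<mu> \<omega> - (1 / Suc n) * D \<omega>"] by simp
    also have "\<dots> \<le> C * ((1 / Suc n) * B)"
      using C DB[of \<omega>] by (intro mult_left_mono) (auto simp: abs_mult divide_right_mono)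
    finally have "\<bar>W (N \<mu> \<omega>) - W (N \<mu> \<omega> - (1 / Suc n) * D \<omega>)\<bar> * Suc n \<le> C * ((1 / Suc n) * B) * Suc n"
      by (rule mult_right_mono) simp
    then show ?thesis by (simp add: q_def abs_mult)
  qed
  have q0: "0 \<le> (LINT \<omega>|M. q n \<omega>)" for n
  proof -
    let ?h = "1 / real (Suc n)"
    have h: "0 \<le> ?h" "?h \<le> 1" by auto
    have iq: "integrable M (q n)" by (rule M.integrable_const_bound[where B = "C * B"]) (use qb in auto)
    have "(LINT \<omega>|M. (W (N \<mu> \<omega>) - W (N ((1 - ?h) *\<^sub>R \<mu>) \<omega>)) * Suc n) \<le> (LINT \<omega>|M. q n \<omega>)"
    proof (rule integral_mono)
      show "integrable M (\<lambda>\<omega>. (W (N \<mu> \<omega>) - W (N ((1 - ?h) *\<^sub>R \<mu>) \<omega>)) * Suc n)"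
        using intN by (intro integrable_mult_left Bochner_Integration.integrable_diff)
      show "(W (N \<mu> \<omega>) - W (N ((1 - ?h) *\<^sub>R \<mu>) \<omega>)) * Suc n \<le> q n \<omega>" for \<omega>
        unfolding q_def using Wmono[OF dir[OF h(1), of \<omega>]] by (intro mult_right_mono) (auto simp: N_def)
    qed (rule iq)
    moreover have "(LINT \<omega>|M. (W (N \<mu> \<omega>) - W (N ((1 - ?h) *\<^sub>R \<mu>) \<omega>)) * Suc n)
        = ((LINT \<omega>|M. W (N \<mu> \<omega>)) - (LINT \<omega>|M. W (N ((1 - ?h) *\<^sub>R \<mu>) \<omega>))) * Suc n"
      using intN by (simp only: integral_mult_left_zero Bochner_Integration.integral_diff)
    moreover have "0 \<le> \<dots>" using dom[OF h] by (intro mult_nonneg_nonneg) auto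
    ultimately show ?thesis by linarith
  qed
  have lim: "(\<lambda>n. q n \<omega>) \<longlonglongrightarrow> D \<omega> * w (N \<mu> \<omega>)" for \<omega>
  proof -
    have "((\<lambda>h. W (N \<mu> \<omega> - h * D \<omega>)) has_real_derivative w (N \<mu> \<omega> - 0 * D \<omega>) * (- D \<omega>)) (at 0)"
      by (rule DERIV_chain2[OF Wd]) (auto intro!: derivative_eq_intros)
    then have "((\<lambda>h. (W (N \<mu> \<omega> - h * D \<omega>) - W (N \<mu> \<omega>)) / h) \<longlongrightarrow> - (w (N \<mu> \<omega>) * D \<omega>)) (at 0)"
      by (simp add: DERIV_def)
    moreover have "filterlim (\<lambda>n. 1 / real (Suc n)) (at 0) sequentially"
      unfolding filterlim_at using LIMSEQ_Suc[OF lim_1_over_n] by (auto simp: frequently_def)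
    ultimately have "(\<lambda>n. (W (N \<mu> \<omega> - 1 / real (Suc n) * D \<omega>) - W (N \<mu> \<omega>)) / (1 / real (Suc n)))
        \<longlonglongrightarrow> - (w (N \<mu> \<omega>) * D \<omega>)"
      by (rule filterlim_compose)
    then have "(\<lambda>n. - ((W (N \<mu> \<omega> - 1 / real (Suc n) * D \<omega>) - W (N \<mu> \<omega>)) / (1 / real (Suc n))))
        \<longlonglongrightarrow> - (- (w (N \<mu> \<omega>) * D \<omega>))"
      by (rule tendsto_minus)
    then show ?thesis by (simp add: q_def[abs_def] algebra_simps)
  qed
  have "(\<lambda>n. LINT \<omega>|M. q n \<omega>) \<longlonglongrightarrow> (LINT \<omega>|M. D \<omega> * w (N \<mu> \<omega>))"
    by (rule integral_dominated_convergence[where w = "\<lambda>_. C * B"]) (use lim qb in auto)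
  then show ?thesis using q0 unfolding N_def by (intro LIMSEQ_le_const) auto
qed

section \<open>Geometry of the first two knots\<close>

abbreviation signed_indices :: "('p \<times> real) set" where
  "signed_indices \<equiv> UNIV \<times> {-1, 1}"

text \<open>Nonstrict, so that tied pairs all lead.\<close>

definition leads :: "'p \<times> real \<Rightarrow> real^'p \<Rightarrow> bool" where
  "leads p U \<longleftrightarrow> (\<forall>j. \<bar>U $ j\<bar> \<le> snd p * U $ fst p)"

lemma leads_iff_infnorm:
  assumes "p \<in> signed_indices"
  shows "leads p U \<longleftrightarrow> snd p * U $ fst p = infnorm U"
proof -
  have "snd p * U $ fst p \<le> infnorm U"
    using assms component_le_infnorm_cart[of U "fst p"] by auto
  then show ?thesis unfolding leads_def infnorm_le_iff_cart[symmetric] by auto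
qed

lemma leading_pair_leads: "leading_pair U \<in> signed_indices" "leads (leading_pair U) U"
proof -
  obtain i where i: "infnorm U = \<bar>U $ i\<bar>" using infnorm_attained by blast
  have "\<exists>q. case q of (i, \<epsilon>) \<Rightarrow> \<epsilon> \<in> {-1, 1} \<and> \<epsilon> * U $ i = infnorm U"
    using i by (intro exI[of _ "(i, if 0 \<le> U $ i then 1 else - 1)"]) auto
  then have "case leading_pair U of (i, \<epsilon>) \<Rightarrow> \<epsilon> \<in> {-1, 1} \<and> \<epsilon> * U $ i = infnorm U"
    unfolding leading_pair_def by (rule someI_ex)
  then show "leading_pair U \<in> signed_indices" "leads (leading_pair U) U"
    by (auto simp: leads_iff_infnorm split: prod.splits)
qed

lemma leading_pair_conv: "leading_pair U = (SOME q. q \<in> {q \<in> signed_indices. leads q U})"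
  unfolding leading_pair_def
  by (rule arg_cong[where f = Eps]) (auto simp: leads_iff_infnorm fun_eq_iff)

lemma leads_measurable [measurable]: "Measurable.pred borel (leads p)"
  unfolding leads_def[abs_def] by measurable

text \<open>The choice operator sees only the set of pairs that attain the norm, which is one of finitely many
  sets.\<close>

lemma leading_pair_measurable: "Measurable.pred borel (\<lambda>U. leading_pair U = p)"
proof -
  have "{U. leading_pair U = p}
      = (\<Union>T \<in> {T \<in> Pow signed_indices. (SOME q. q \<in> T) = p}.
           {U. \<forall>q \<in> signed_indices. leads q U \<longleftrightarrow> q \<in> T})"
    unfolding leading_pair_conv
  proof (intro set_eqI iffI)
    fix U assume U: "U \<in> {U. (SOME q. q \<in> {q \<in> signed_indices. leads q U}) = p}"
    then show "U \<in> (\<Union>T \<in> {T \<in> Pow signed_indices. (SOME q. q \<in> T) = p}.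
           {U. \<forall>q \<in> signed_indices. leads q U \<longleftrightarrow> q \<in> T})"
      by (intro UN_I[of "{q \<in> signed_indices. leads q U}"]) auto
  next
    fix U assume "U \<in> (\<Union>T \<in> {T \<in> Pow signed_indices. (SOME q. q \<in> T) = p}.
           {U. \<forall>q \<in> signed_indices. leads q U \<longleftrightarrow> q \<in> T})"
    then obtain T where T: "T \<subseteq> signed_indices" "(SOME q. q \<in> T) = p"
      and eq: "\<forall>q \<in> signed_indices. leads q U \<longleftrightarrow> q \<in> T" by blast
    then have "T = {q \<in> signed_indices. leads q U}" by blast
    then show "U \<in> {U. (SOME q. q \<in> {q \<in> signed_indices. leads q U}) = p}" using T by simp
  qed
  moreover have "{U. \<forall>q \<in> signed_indices. leads q U \<longleftrightarrow> q \<in> T} \<in> sets borel" for T :: "('a \<times> real) set"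
    by measurable
  ultimately show ?thesis by (auto simp: pred_def intro!: sets.finite_UN)
qed

lemma leading_pair_cases_sum:
  fixes F :: "'p \<times> real \<Rightarrow> real^'p \<Rightarrow> real"
  shows "F (leading_pair U) U = (\<Sum>p\<in>signed_indices. of_bool (leading_pair U = p) * F p U)"
proof -
  have "(\<Sum>p\<in>signed_indices. of_bool (leading_pair U = p) * F p U)
      = (\<Sum>p\<in>signed_indices. if p = leading_pair U then F p U else 0)"
    by (intro sum.cong) auto
  then show ?thesis using leading_pair_leads(1)[of U] by (simp add: sum.delta del: mem_Times_iff)
qed

lemma leading_pair_dependent_measurable:
  fixes F :: "'p \<times> real \<Rightarrow> real^'p \<Rightarrow> real"
  assumes [measurable]: "\<And>p. F p \<in> borel_measurable borel"
  shows "(\<lambda>U. F (leading_pair U) U) \<in> borel_measurable borel"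
proof -
  note leading_pair_measurable [measurable]
  show ?thesis unfolding leading_pair_cases_sum by measurable
qed

text \<open>The part of the score vector that is uncorrelated with its coordinate \<open>i\<close> when \<open>R\<close> is the
  covariance matrix and \<open>R $ i $ i = 1\<close>.\<close>

definition residual :: "real^'p^'p \<Rightarrow> 'p \<Rightarrow> real^'p \<Rightarrow> real^'p" where
  "residual R i U = (\<chi> j. U $ j - R $ j $ i * U $ i)"

text \<open>A function of the residual, so that its independence from the leading coordinate can be used.\<close>

definition second_knot :: "real^'p^'p \<Rightarrow> 'p \<times> real \<Rightarrow> real^'p \<Rightarrow> real" where
  "second_knot R p V =
     (if UNIV - {fst p} = {} then 0
      else Max ((\<lambda>j. max (V $ j / (1 - snd p * R $ j $ fst p)) (- V $ j / (1 + snd p * R $ j $ fst p)))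
                ` (UNIV - {fst p})))"

lemma lars_knot2_conv:
  "lars_knot2 R U = second_knot R (leading_pair U) (residual R (fst (leading_pair U)) U)"
  by (simp add: lars_knot2_def second_knot_def residual_def lead_index_def lead_sign_def Let_def minus_diff_eq)

lemma knot_entry_nonneg:
  fixes v r :: real
  assumes "\<bar>r\<bar> \<le> 1"
  shows "0 \<le> max (v / (1 - r)) (- v / (1 + r))"
  using assms divide_nonneg_nonneg[of v "1 - r"] divide_nonneg_nonneg[of "- v" "1 + r"]
  unfolding le_max_iff_disj by (cases "0 \<le> v") auto

text \<open>For \<open>r = 1\<close> or \<open>r = - 1\<close> one of the two inequalities in \<open>\<bar>v + r * z\<bar> \<le> z\<close> does not involve
  \<open>z\<close>. The corresponding quotient is \<open>0\<close> by the convention for division by zero, which does no harm as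
  \<open>z \<ge> 0\<close>, and the sign of \<open>v\<close> appears as a separate condition.\<close>

lemma slab_iff_knot_entry:
  fixes v r z :: real
  assumes r: "\<bar>r\<bar> \<le> 1" and z: "0 \<le> z"
  shows "\<bar>v + r * z\<bar> \<le> z \<longleftrightarrow> (r = 1 \<longrightarrow> v \<le> 0) \<and> (r = - 1 \<longrightarrow> 0 \<le> v) \<and> max (v / (1 - r)) (- v / (1 + r)) \<le> z"
proof -
  consider "r = 1" | "r = - 1" | "- 1 < r" "r < 1" using r by linarith
  then show ?thesis
  proof cases
    case 3
    then have "v / (1 - r) \<le> z \<longleftrightarrow> v \<le> z * (1 - r)" "- v / (1 + r) \<le> z \<longleftrightarrow> - v \<le> z * (1 + r)"
      using pos_divide_le_eq[of "1 - r" v z] pos_divide_le_eq[of "1 + r" "- v" z] by simp_all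
    then show ?thesis using 3 by (auto simp: algebra_simps abs_le_iff)
  qed (use z in auto)
qed

lemma second_knot_nonneg:
  assumes "\<And>j. \<bar>snd p * R $ j $ fst p\<bar> \<le> 1"
  shows "0 \<le> second_knot R p V"
proof (cases "UNIV - {fst p} = {}")
  case False
  then obtain j where j: "j \<in> UNIV - {fst p}" by blast
  have "0 \<le> max (V $ j / (1 - snd p * R $ j $ fst p)) (- V $ j / (1 + snd p * R $ j $ fst p))"
    by (rule knot_entry_nonneg[OF assms])
  also have "\<dots> \<le> second_knot R p V"
    unfolding second_knot_def if_not_P[OF False] by (rule Max_ge) (use j in auto)
  finally show ?thesis .
qed (simp add: second_knot_def)

lemma second_knot_le_iff:
  assumes "0 \<le> z"
  shows "second_knot R p V \<le> z \<longleftrightarrow>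
    (\<forall>j\<in>UNIV - {fst p}. max (V $ j / (1 - snd p * R $ j $ fst p)) (- V $ j / (1 + snd p * R $ j $ fst p)) \<le> z)"
proof (cases "UNIV - {fst p} = {}")
  case True
  then show ?thesis using assms by (simp only: second_knot_def if_P) simp
next
  case False
  then show ?thesis unfolding second_knot_def if_not_P[OF False] by (subst Max_le_iff) auto
qed

text \<open>The conditions on the residual that come from predictors perfectly correlated with predictor
  \<open>fst p\<close>; they hold or fail whatever the value of the leading coordinate.\<close>

definition leads_feasible :: "real^'p^'p \<Rightarrow> 'p \<times> real \<Rightarrow> real^'p \<Rightarrow> bool" where
  "leads_feasible R p V \<longleftrightarrow> (\<forall>j\<in>UNIV - {fst p}.
     (snd p * R $ j $ fst p = 1 \<longrightarrow> V $ j \<le> 0) \<and> (snd p * R $ j $ fst p = - 1 \<longrightarrow> 0 \<le> V $ j))"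

text \<open>This turns the selection event into a half-line for \<open>z\<close> once the residual is fixed.\<close>

lemma leads_iff_second_knot:
  assumes p: "p \<in> signed_indices" and corr: "\<And>j. \<bar>snd p * R $ j $ fst p\<bar> \<le> 1"
    and V: "V = residual R (fst p) U" and z: "z = snd p * U $ fst p"
  shows "leads p U \<longleftrightarrow> leads_feasible R p V \<and> second_knot R p V \<le> z"
proof -
  have sgn: "snd p * snd p = 1" using p by auto
  have Ui: "U $ fst p = snd p * z" by (simp add: z sgn flip: mult.assoc)
  have Uj: "U $ j = V $ j + (snd p * R $ j $ fst p) * z" for j
    unfolding V residual_def using Ui by simp
  show ?thesis
  proof (cases "0 \<le> z")
    case True
    have self: "\<bar>U $ fst p\<bar> \<le> z" using True p unfolding Ui by auto
    have "leads p U \<longleftrightarrow> (\<forall>j\<in>UNIV - {fst p}. \<bar>U $ j\<bar> \<le> z)"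
      unfolding leads_def z[symmetric] using self by (metis DiffI UNIV_I singletonD)
    also have "\<dots> \<longleftrightarrow> leads_feasible R p V \<and> second_knot R p V \<le> z"
      unfolding second_knot_le_iff[OF True] leads_feasible_def Uj slab_iff_knot_entry[OF corr True] by blast
    finally show ?thesis .
  next
    case False
    moreover have "\<not> leads p U"
      using False abs_ge_zero[of "U $ fst p"] unfolding leads_def z[symmetric] by (meson order_trans)
    ultimately show ?thesis using second_knot_nonneg[OF corr, of V] by linarith
  qed
qed

lemma covariance_correlation_bound:
  assumes R: "covariance_matrix R" and diag: "\<And>i. R $ i $ i = 1"
  shows "\<bar>R $ j $ i\<bar> \<le> 1"
proof -
  have entry: "axis k 1 \<bullet> (R *v axis l 1) = R $ k $ l" for k l
    by (simp add: inner_axis' matrix_vector_mult_basis column_def)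
  have sym: "R $ i $ j = R $ j $ i"
    using covariance_symmetric[OF R, of "axis i 1" "axis j 1"] unfolding entry
    by (simp add: inner_commute entry)
  have "0 \<le> (axis j 1 + s *\<^sub>R axis i 1) \<bullet> (R *v (axis j 1 + s *\<^sub>R axis i 1))" for s :: real
    using R unfolding covariance_matrix_def by blast
  then have "0 \<le> 1 + 2 * (s * R $ j $ i) + s * s" for s
    by (simp add: matrix_vector_right_distrib matrix_vector_mult_scaleR inner_add_left inner_add_right entry diag sym algebra_simps)
  from this[of 1] this[of "- 1"] show ?thesis by (simp add: abs_le_iff)
qed

text \<open>Rejection indicator minus level minus the linear drift term, as if \<open>p\<close> were the leading pair. The
  maximum with \<open>0\<close> makes the function bounded on the whole space and changes nothing where \<open>p\<close> leads.\<close>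

definition pair_excess :: "real \<Rightarrow> real^'p^'p \<Rightarrow> real^'p \<Rightarrow> 'p \<times> real \<Rightarrow> real^'p \<Rightarrow> real" where
  "pair_excess \<alpha> R \<mu> p U = (let z = snd p * U $ fst p in
     of_bool (std_normal_tail z \<le> \<alpha> * std_normal_tail (second_knot R p (residual R (fst p) U)))
     - \<alpha> - \<alpha> * (snd p * \<mu> $ fst p) * (rejection_threshold \<alpha> (max 0 z) - max 0 z))"

lemma residual_measurable [measurable]: "residual R i \<in> borel_measurable borel"
  unfolding residual_def
  by (intro borel_measurable_continuous_onI continuous_intros)

lemma second_knot_measurable [measurable]: "second_knot R p \<in> borel_measurable borel"
proof (cases "UNIV - {fst p} = {}")
  case True
  then show ?thesis unfolding second_knot_def[abs_def] by (simp only: if_P) simp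
next
  case False
  show ?thesis unfolding second_knot_def[abs_def] if_not_P[OF False]
    by (rule borel_measurable_Max) auto
qed

lemma std_normal_tail_measurable [measurable]: "std_normal_tail \<in> borel_measurable borel"
  by (intro borel_measurable_continuous_onI continuous_at_imp_continuous_on ballI isCont_std_normal_tail)

lemma pair_excess_measurable:
  assumes "0 < \<alpha>" "\<alpha> < 1"
  shows "pair_excess \<alpha> R \<mu> p \<in> borel_measurable borel"
proof -
  note [measurable] = rejection_threshold_measurable[OF assms]
  show ?thesis unfolding pair_excess_def[abs_def] Let_def by measurable
qed

lemma pair_excess_bounded:
  assumes \<alpha>: "0 < \<alpha>" "\<alpha> < 1"
  shows "\<bar>pair_excess \<alpha> R \<mu> p U\<bar> \<le> 1 + \<alpha> + \<alpha> * \<bar>snd p * \<mu> $ fst p\<bar> * sqrt (2 * ln (1 / \<alpha>))"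
proof -
  define y where "y = max 0 (snd p * U $ fst p)"
  define X where "X = \<alpha> * (snd p * \<mu> $ fst p) * (rejection_threshold \<alpha> y - y)"
  have "0 \<le> y" by (simp add: y_def)
  then have "0 \<le> rejection_threshold \<alpha> y - y" "rejection_threshold \<alpha> y - y \<le> sqrt (2 * ln (1 / \<alpha>))"
    using rejection_threshold_gt[OF \<alpha>, of y] rejection_threshold_gap_bounded[OF \<alpha>] by auto
  then have "\<bar>X\<bar> \<le> \<alpha> * \<bar>snd p * \<mu> $ fst p\<bar> * sqrt (2 * ln (1 / \<alpha>))"
    unfolding X_def abs_mult using \<alpha> by (intro mult_mono) auto
  moreover have "\<bar>of_bool b - \<alpha> - X\<bar> \<le> 1 + \<alpha> + \<bar>X\<bar>" for b
    using \<alpha> by (cases b) auto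
  ultimately show ?thesis unfolding pair_excess_def Let_def y_def[symmetric] X_def[symmetric]
    by (meson add_left_mono order_trans)
qed

text \<open>Conditioning on the residual of \<open>fst p\<close> reduces this to \<open>shifted_rejection_lower_bound\<close>.\<close>

lemma leading_pair_excess_nonneg:
  fixes R :: "real^'p^'p"
  assumes M: "prob_space M" and U: "multivariate_normal M U \<mu> R" and diag: "\<And>i. R $ i $ i = 1"
    and \<alpha>: "0 < \<alpha>" "\<alpha> < 1" and p: "p \<in> signed_indices"
  shows "0 \<le> (LINT \<omega>|M. of_bool (leads p (U \<omega>)) * pair_excess \<alpha> R \<mu> p (U \<omega>))"
proof -
  interpret M: prob_space M by fact
  have R: "covariance_matrix R" using U by (simp add: multivariate_normal_def)
  note [measurable] = pair_excess_measurable[OF \<alpha>]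
  have corr: "\<bar>snd p * R $ j $ fst p\<bar> \<le> 1" for j
    using covariance_correlation_bound[OF R diag, of j "fst p"] p by (auto simp: abs_mult)
  have sgn: "snd p * snd p = 1" using p by auto
  \<comment> \<open>With this direction \<open>a \<bullet> U\<close> is the signed coordinate itself.\<close>
  define a :: "real^'p" where "a = axis (fst p) (snd p)"
  define c where "c = R *v a"
  have ax: "a = snd p *\<^sub>R axis (fst p) 1" by (simp add: a_def vec_eq_iff axis_def)
  have cj: "c $ j = snd p * R $ j $ fst p" for j
    unfolding c_def ax by (simp add: matrix_vector_mult_scaleR matrix_vector_mult_basis column_def)
  have ax_inner: "a \<bullet> x = snd p * x $ fst p" for x by (simp add: a_def inner_axis')
  have a1: "a \<bullet> (R *v a) = 1"
    unfolding c_def[symmetric] ax_inner cj by (simp add: diag sgn)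
  define m where "m = snd p * \<mu> $ fst p"
  have am: "a \<bullet> \<mu> = m" by (simp add: ax_inner m_def)
  let ?f = "\<lambda>x. of_bool (leads p x) * pair_excess \<alpha> R \<mu> p x"
  have fm: "?f \<in> borel_measurable borel" by measurable
  have fb: "\<bar>?f x\<bar> \<le> 1 + \<alpha> + \<alpha> * \<bar>m\<bar> * sqrt (2 * ln (1 / \<alpha>))" for x
    using pair_excess_bounded[OF \<alpha>, of R \<mu> p x] unfolding m_def
    by (cases "leads p x") (auto intro: order_trans[OF abs_ge_zero])
  define V where "V \<omega> = U \<omega> - (a \<bullet> U \<omega>) *\<^sub>R c" for \<omega>
  have Vi: "V \<omega> $ fst p = 0" for \<omega>
    by (simp add: V_def ax_inner cj diag mult.commute sgn flip: mult.assoc)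
  have inner: "0 \<le> (LINT z|normal_law m 1. ?f (z *\<^sub>R c + V \<omega>))" for \<omega>
  proof -
    let ?l = "second_knot R p (V \<omega>)"
    have z: "snd p * (z *\<^sub>R c + V \<omega>) $ fst p = z" for z
      using sgn by (simp add: Vi cj diag)
    have res: "residual R (fst p) (z *\<^sub>R c + V \<omega>) = V \<omega>" for z
      by (simp add: residual_def vec_eq_iff cj Vi diag)
    have l0: "0 \<le> ?l" by (rule second_knot_nonneg[OF corr])
    have lead: "leads p (z *\<^sub>R c + V \<omega>) \<longleftrightarrow> leads_feasible R p (V \<omega>) \<and> ?l \<le> z" for z
      using leads_iff_second_knot[OF p corr refl refl, of "z *\<^sub>R c + V \<omega>"] unfolding z res .
    have "?f (z *\<^sub>R c + V \<omega>) = of_bool (leads_feasible R p (V \<omega>)) * (indicator {?l..} z *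
      (of_bool (std_normal_tail z \<le> \<alpha> * std_normal_tail ?l) - \<alpha> - \<alpha> * m * (rejection_threshold \<alpha> z - z)))" for z
      unfolding pair_excess_def z res lead Let_def m_def using l0 by (auto simp: indicator_def max_def)
    then have "(LINT z|normal_law m 1. ?f (z *\<^sub>R c + V \<omega>))
      = of_bool (leads_feasible R p (V \<omega>)) * (LINT z|normal_law m 1. indicator {?l..} z *
      (of_bool (std_normal_tail z \<le> \<alpha> * std_normal_tail ?l) - \<alpha> - \<alpha> * m * (rejection_threshold \<alpha> z - z)))"
      by (simp only: integral_mult_right_zero)
    then show ?thesis using shifted_rejection_lower_bound[OF \<alpha> l0, of m] by simp
  qed
  have "(LINT \<omega>|M. ?f (U \<omega>)) = (LINT \<omega>|M. LINT z|normal_law m 1. ?f (z *\<^sub>R c + V \<omega>))"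
    using mvn_integral_decomposition[OF M U a1 c_def fm fb] unfolding am V_def .
  then show ?thesis using inner by (simp only:) (rule Bochner_Integration.integral_nonneg, simp)
qed

section \<open>Ties and unbiasedness\<close>

lemma normal_law_zero_one:
  assumes "0 \<le> v"
  shows "(AE x in normal_law m v. x = 0) \<or> (AE x in normal_law m v. x \<noteq> 0)"
proof (cases "v = 0")
  case True
  then have "normal_law m v = return borel m" by (simp add: normal_law_def)
  then show ?thesis by (cases "m = 0") (simp_all only:, (subst AE_return; simp)+)
next
  case False
  then have *: "normal_law m v = density lborel (\<lambda>x. ennreal (normal_density m (sqrt v) x))"
    by (simp add: normal_law_def)
  have "AE x in normal_law m v. x \<noteq> 0"
    unfolding * using AE_lborel_singleton[of 0] by (subst AE_density) (auto elim: eventually_mono)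
  then show ?thesis ..
qed

lemma mvn_projection_zero_one:
  assumes U: "multivariate_normal M U \<mu> R"
  shows "(AE \<omega> in M. b \<bullet> U \<omega> = 0) \<or> (AE \<omega> in M. b \<bullet> U \<omega> \<noteq> 0)"
proof -
  have [measurable]: "U \<in> borel_measurable M" by (rule mvn_measurable[OF U])
  have "0 \<le> b \<bullet> (R *v b)" and law: "distr M borel (\<lambda>\<omega>. b \<bullet> U \<omega>) = normal_law (b \<bullet> \<mu>) (b \<bullet> (R *v b))"
    using U by (auto simp: multivariate_normal_def covariance_matrix_def)
  from normal_law_zero_one[OF this(1), of "b \<bullet> \<mu>"]
  have "(AE x in distr M borel (\<lambda>\<omega>. b \<bullet> U \<omega>). x = 0) \<or> (AE x in distr M borel (\<lambda>\<omega>. b \<bullet> U \<omega>). x \<noteq> 0)"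
    unfolding law .
  then show ?thesis
    by (elim disj_forward) (erule AE_distrD[rotated], measurable)+
qed

text \<open>Two signed coordinates differ by a Gaussian variable, which is zero almost surely or almost never. So,
  almost surely, the set of pairs tied with \<open>p\<close> is a fixed set, and the choice among them is a fixed
  pair. The predicate \<open>r\<close> marks the pairs that are chosen from their own set.\<close>

lemma leading_pair_almost_determined:
  fixes R :: "real^'p^'p"
  assumes M: "prob_space M" and U: "multivariate_normal M U \<mu> R"
  obtains r where "AE \<omega> in M. \<forall>p\<in>signed_indices. leading_pair (U \<omega>) = p \<longleftrightarrow> leads p (U \<omega>) \<and> r p"
proof -
  interpret M: prob_space M by fact
  define tie where "tie p q \<omega> \<longleftrightarrow> snd q * U \<omega> $ fst q = snd p * U \<omega> $ fst p" for p q and \<omega>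
  define c where "c p = {q \<in> signed_indices. AE \<omega> in M. tie p q \<omega>}" for p
  have zo: "(AE \<omega> in M. tie p q \<omega>) \<or> (AE \<omega> in M. \<not> tie p q \<omega>)" for p q
  proof -
    have "axis (fst q) (snd q) \<bullet> x - axis (fst p) (snd p) \<bullet> x = snd q * x $ fst q - snd p * x $ fst p" for x :: "real^'p"
      by (simp add: inner_axis')
    then show ?thesis
      using mvn_projection_zero_one[OF U, of "axis (fst q) (snd q) - axis (fst p) (snd p)"]
      by (simp add: inner_diff_left tie_def)
  qed
  have "AE \<omega> in M. tie p q \<omega> \<longleftrightarrow> (AE \<omega> in M. tie p q \<omega>)" for p q
  proof (cases "AE \<omega> in M. tie p q \<omega>")
    case True
    then show ?thesis by eventually_elim (use True in simp)
  next
    case False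
    then have "AE \<omega> in M. \<not> tie p q \<omega>" using zo by blast
    then show ?thesis by eventually_elim (use False in simp)
  qed
  then have "AE \<omega> in M. \<forall>p\<in>signed_indices. \<forall>q\<in>signed_indices. tie p q \<omega> \<longleftrightarrow> (AE \<omega> in M. tie p q \<omega>)"
    by (intro AE_finite_allI) auto
  then have "AE \<omega> in M. \<forall>p\<in>signed_indices. leading_pair (U \<omega>) = p \<longleftrightarrow>
      leads p (U \<omega>) \<and> (SOME q. q \<in> c p) = p"
  proof eventually_elim
    case (elim \<omega>)
    have set: "{q \<in> signed_indices. leads q (U \<omega>)} = c p" if p: "p \<in> signed_indices" "leads p (U \<omega>)" for p
    proof -
      have "leads q (U \<omega>) \<longleftrightarrow> tie p q \<omega>" if "q \<in> signed_indices" for q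
        using p that by (simp only: leads_iff_infnorm tie_def)
      then show ?thesis using elim p unfolding c_def by blast
    qed
    show ?case
    proof
      fix p :: "'p \<times> real" assume p: "p \<in> signed_indices"
      show "leading_pair (U \<omega>) = p \<longleftrightarrow> leads p (U \<omega>) \<and> (SOME q. q \<in> c p) = p"
      proof
        assume lp: "leading_pair (U \<omega>) = p"
        then have "leads p (U \<omega>)" using leading_pair_leads(2)[of "U \<omega>"] by simp
        then show "leads p (U \<omega>) \<and> (SOME q. q \<in> c p) = p"
          using lp leading_pair_conv[of "U \<omega>"] set[OF p] by simp
      next
        assume "leads p (U \<omega>) \<and> (SOME q. q \<in> c p) = p"
        then show "leading_pair (U \<omega>) = p"
          using leading_pair_conv[of "U \<omega>"] set[OF p] by simp
      qed
    qed
  qed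
  then show ?thesis by (rule that)
qed

lemma mvn_translate:
  assumes xi: "multivariate_normal M \<xi> m \<Sigma>"
  shows "multivariate_normal M (\<lambda>\<omega>. u + \<xi> \<omega>) (u + m) \<Sigma>"
proof -
  have [measurable]: "\<xi> \<in> borel_measurable M" by (rule mvn_measurable[OF xi])
  have "distr M borel (\<lambda>\<omega>. a \<bullet> (u + \<xi> \<omega>)) = normal_law (a \<bullet> (u + m)) (a \<bullet> (\<Sigma> *v a))" for a
  proof -
    have v: "0 \<le> a \<bullet> (\<Sigma> *v a)" and law: "distr M borel (\<lambda>\<omega>. a \<bullet> \<xi> \<omega>) = normal_law (a \<bullet> m) (a \<bullet> (\<Sigma> *v a))"
      using xi by (auto simp: multivariate_normal_def covariance_matrix_def)
    have "distr M borel (\<lambda>\<omega>. a \<bullet> (u + \<xi> \<omega>)) = distr (distr M borel (\<lambda>\<omega>. a \<bullet> \<xi> \<omega>)) borel (\<lambda>x. a \<bullet> u + x)"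
      by (subst distr_distr) (auto simp: comp_def inner_add_right)
    also have "\<dots> = normal_law (a \<bullet> (u + m)) (a \<bullet> (\<Sigma> *v a))"
      unfolding law normal_law_affine[OF v] by (subst distr_distr) (auto simp: comp_def inner_add_right add.assoc)
    finally show ?thesis .
  qed
  then show ?thesis using xi by (simp add: multivariate_normal_def)
qed

lemma spacing_rejects_iff:
  "spacing_statistic R U \<le> \<alpha> \<longleftrightarrow>
     std_normal_tail (lars_knot1 U) \<le> \<alpha> * std_normal_tail (lars_knot2 R U)"
  unfolding spacing_statistic_def by (rule pos_divide_le_eq[OF std_normal_tail_pos])

lemma lars_knot1_eq_infnorm: "lars_knot1 U = infnorm U"
  using leading_pair_leads[of U] leads_iff_infnorm[of "leading_pair U" U]
  by (simp add: lars_knot1_def lead_sign_def lead_index_def)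

lemma spacing_statistic_measurable [measurable]: "spacing_statistic R \<in> borel_measurable borel"
proof -
  have "(\<lambda>U. std_normal_tail (snd p * U $ fst p) / std_normal_tail (second_knot R p (residual R (fst p) U)))
      \<in> borel_measurable borel" for p
    by measurable
  from leading_pair_dependent_measurable[OF this] show ?thesis
    by (simp add: spacing_statistic_def[abs_def] lars_knot1_def lars_knot2_conv lead_sign_def lead_index_def)
qed

text \<open>For \<open>\<mu> = 0\<close> this bounds the size of the test under the null hypothesis from below.\<close>

lemma spacing_test_power:
  fixes R :: "real^'p^'p"
  assumes M: "prob_space M" and xi: "multivariate_normal M \<xi> 0 R" and diag: "\<And>i. R $ i $ i = 1"
    and \<alpha>: "0 < \<alpha>" "\<alpha> < 1"
  shows "\<alpha> \<le> measure M {\<omega> \<in> space M. spacing_statistic R (\<mu> + \<xi> \<omega>) \<le> \<alpha>}"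
proof -
  interpret M: prob_space M by fact
  define U where "U \<omega> = \<mu> + \<xi> \<omega>" for \<omega>
  have U: "multivariate_normal M U \<mu> R"
    using mvn_translate[OF xi, of \<mu>] by (simp add: U_def[abs_def])
  have [measurable]: "U \<in> borel_measurable M" by (rule mvn_measurable[OF U])
  note [measurable] = rejection_threshold_measurable[OF \<alpha>] pair_excess_measurable[OF \<alpha>]
  define w where "w t = rejection_threshold \<alpha> (max 0 t) - max 0 t" for t
  define D where "D \<omega> = lead_sign (U \<omega>) * \<mu> $ lead_index (U \<omega>)" for \<omega>
  have w: "isCont w t" "0 \<le> w t" "w t \<le> sqrt (2 * ln (1 / \<alpha>))" for t
  proof -
    have m: "isCont (\<lambda>t::real. max 0 t) t" by (intro continuous_intros)
    show "isCont w t" unfolding w_def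
      by (intro continuous_intros m isCont_o2[OF m isCont_rejection_threshold[OF \<alpha>]])
    show "0 \<le> w t" using rejection_threshold_gt[OF \<alpha>, of "max 0 t"] by (simp add: w_def)
    show "w t \<le> sqrt (2 * ln (1 / \<alpha>))"
      unfolding w_def by (rule rejection_threshold_gap_bounded[OF \<alpha>]) simp
  qed
  have wm [measurable]: "w \<in> borel_measurable borel"
    using w(1) by (intro borel_measurable_continuous_onI continuous_at_imp_continuous_on ballI)
  have Dm [measurable]: "D \<in> borel_measurable M"
  proof -
    have "(\<lambda>U. snd (leading_pair U) * \<mu> $ fst (leading_pair U)) \<in> borel_measurable borel"
      by (rule leading_pair_dependent_measurable[where F = "\<lambda>p U. snd p * \<mu> $ fst p"]) simp
    then show ?thesis unfolding D_def lead_sign_def lead_index_def by measurable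
  qed
  have Db: "\<bar>D \<omega>\<bar> \<le> infnorm \<mu>" for \<omega>
    using leading_pair_leads(1)[of "U \<omega>"] component_le_infnorm_cart[of \<mu> "lead_index (U \<omega>)"]
    by (auto simp: D_def lead_sign_def abs_mult mem_Times_iff)
  \<comment> \<open>\<open>D\<close> is the slope at the leading pair: the norm of \<open>U - h *\<^sub>R \<mu>\<close> is at least the value of the signed coordinate that leads at \<open>U\<close>.\<close>
  have drift: "0 \<le> (LINT \<omega>|M. D \<omega> * w (infnorm (U \<omega>)))"
    unfolding U_def
  proof (rule infnorm_directional_moment_nonneg[OF M xi w Dm Db])
    fix \<omega> and h :: real assume h: "0 \<le> h"
    have s: "lead_sign (U \<omega>) \<in> {-1, 1}" using leading_pair_leads(1)[of "U \<omega>"] by (auto simp: lead_sign_def mem_Times_iff)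
    have "infnorm (U \<omega>) - h * D \<omega> = lead_sign (U \<omega>) * (U \<omega> - h *\<^sub>R \<mu>) $ lead_index (U \<omega>)"
      using lars_knot1_eq_infnorm[of "U \<omega>"] by (simp add: D_def lars_knot1_def algebra_simps)
    also have "\<dots> \<le> infnorm (U \<omega> - h *\<^sub>R \<mu>)"
      using s component_le_infnorm_cart[of "U \<omega> - h *\<^sub>R \<mu>" "lead_index (U \<omega>)"] by auto
    also have "U \<omega> - h *\<^sub>R \<mu> = (1 - h) *\<^sub>R \<mu> + \<xi> \<omega>" by (simp add: U_def algebra_simps)
    finally show "infnorm (\<mu> + \<xi> \<omega>) - h * D \<omega> \<le> infnorm ((1 - h) *\<^sub>R \<mu> + \<xi> \<omega>)"
      by (simp add: U_def)
  qed
  obtain r where r: "AE \<omega> in M. \<forall>p\<in>signed_indices. leading_pair (U \<omega>) = p \<longleftrightarrow> leads p (U \<omega>) \<and> r p"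
    using leading_pair_almost_determined[OF M U] by blast
  define E where "E p \<omega> = of_bool (leads p (U \<omega>)) * pair_excess \<alpha> R \<mu> p (U \<omega>)" for p \<omega>
  have Em [measurable]: "E p \<in> borel_measurable M" for p unfolding E_def by measurable
  have Eint: "integrable M (E p)" for p
    by (rule M.integrable_const_bound[where B = "1 + \<alpha> + \<alpha> * \<bar>snd p * \<mu> $ fst p\<bar> * sqrt (2 * ln (1 / \<alpha>))"])
      (use pair_excess_bounded[OF \<alpha>, of R \<mu> p] in \<open>auto simp: E_def intro: order_trans[OF abs_ge_zero]\<close>)
  let ?S = "{\<omega> \<in> space M. spacing_statistic R (U \<omega>) \<le> \<alpha>}"
  have excess: "pair_excess \<alpha> R \<mu> (leading_pair (U \<omega>)) (U \<omega>)
      = indicator ?S \<omega> - \<alpha> - \<alpha> * (D \<omega> * w (infnorm (U \<omega>)))" if "\<omega> \<in> space M" for \<omega>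
    using that lars_knot1_eq_infnorm[of "U \<omega>"]
    unfolding pair_excess_def Let_def w_def D_def spacing_rejects_iff lars_knot2_conv
    by (simp add: lars_knot1_def lead_sign_def lead_index_def indicator_def mult.assoc)
  \<comment> \<open>Summing over the pairs marked by \<open>r\<close> recovers, almost surely, the excess at the leading pair.\<close>
  have "0 \<le> (\<Sum>p\<in>signed_indices. of_bool (r p) * (LINT \<omega>|M. E p \<omega>))"
    using leading_pair_excess_nonneg[OF M U diag \<alpha>] unfolding E_def
    by (intro sum_nonneg mult_nonneg_nonneg) auto
  also have "\<dots> = (LINT \<omega>|M. (\<Sum>p\<in>signed_indices. of_bool (r p) * E p \<omega>))"
    using Eint by (subst Bochner_Integration.integral_sum) auto
  also have "\<dots> = (LINT \<omega>|M. indicator ?S \<omega> - \<alpha> - \<alpha> * (D \<omega> * w (infnorm (U \<omega>))))"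
  proof (rule integral_cong_AE)
    show "AE \<omega> in M. (\<Sum>p\<in>signed_indices. of_bool (r p) * E p \<omega>)
        = indicator ?S \<omega> - \<alpha> - \<alpha> * (D \<omega> * w (infnorm (U \<omega>)))"
      using r AE_space
    proof eventually_elim
      case (elim \<omega>)
      have "(\<Sum>p\<in>signed_indices. of_bool (r p) * E p \<omega>)
          = (\<Sum>p\<in>signed_indices. of_bool (leading_pair (U \<omega>) = p) * pair_excess \<alpha> R \<mu> p (U \<omega>))"
        using elim(1) by (intro sum.cong) (auto simp: E_def)
      also have "\<dots> = pair_excess \<alpha> R \<mu> (leading_pair (U \<omega>)) (U \<omega>)"
        by (rule leading_pair_cases_sum[symmetric])
      finally show ?case using excess elim(2) by simp
    qed
  qed measurable
  also have "\<dots> = measure M ?S - \<alpha> - \<alpha> * (LINT \<omega>|M. D \<omega> * w (infnorm (U \<omega>)))"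
  proof -
    have b: "\<bar>D \<omega> * w (infnorm (U \<omega>))\<bar> \<le> infnorm \<mu> * sqrt (2 * ln (1 / \<alpha>))" for \<omega>
      unfolding abs_mult using Db[of \<omega>] w[of "infnorm (U \<omega>)"] by (intro mult_mono) (auto simp: infnorm_pos_le)
    have i1: "integrable M (\<lambda>\<omega>. D \<omega> * w (infnorm (U \<omega>)))"
      by (rule M.integrable_const_bound[where B = "infnorm \<mu> * sqrt (2 * ln (1 / \<alpha>))"]) (use b in auto)
    have i2: "integrable M (indicator ?S :: _ \<Rightarrow> real)"
      by (rule M.integrable_const_bound[where B = 1]) auto
    have "?S \<inter> space M = ?S" by auto
    then show ?thesis using i1 i2 M.prob_space by simp
  qed
  finally have "\<alpha> * (LINT \<omega>|M. D \<omega> * w (infnorm (U \<omega>))) \<le> measure M ?S - \<alpha>" by simp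
  moreover have "0 \<le> \<alpha> * (LINT \<omega>|M. D \<omega> * w (infnorm (U \<omega>)))" using drift \<alpha> by simp
  ultimately show ?thesis by (simp add: U_def)
qed

theorem theorem1:
  fixes M :: "'a measure"
    and X :: "real^'p^'n"
    and \<Sigma> :: "real^'n^'n"
    and \<beta> :: "real^'p"
    and \<xi> Y :: "'a \<Rightarrow> real^'n"
    and \<alpha> :: real
  assumes prob: "prob_space M"
    and level: "0 < \<alpha>" "\<alpha> < 1"
    and columns: "inj (\<lambda>i. column i X)"
    and noise: "multivariate_normal M \<xi> 0 \<Sigma>"
    and model: "\<And>\<omega>. \<omega> \<in> space M \<Longrightarrow> Y \<omega> = X *v \<beta> + \<xi> \<omega>"
    and normalized: "\<And>i. column i X \<bullet> (\<Sigma> *v column i X) = 1"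
    and alternative: "\<beta> \<notin> {b. X *v b = 0}"
  shows "measure M {\<omega> \<in> space M.
           spacing_statistic (transpose X ** \<Sigma> ** X) (transpose X *v Y \<omega>) \<le> \<alpha>} \<ge> \<alpha>"
proof -
  let ?R = "transpose X ** \<Sigma> ** X" and ?\<mu> = "transpose X *v (X *v \<beta>)"
  have corr: "multivariate_normal M (\<lambda>\<omega>. transpose X *v \<xi> \<omega>) 0 ?R"
    using mvn_linear_image[OF noise, of "transpose X"] by (simp add: transpose_transpose)
  have diag: "?R $ i $ i = 1" for i
  proof -
    have "?R $ i $ i = axis i 1 \<bullet> (?R *v axis i 1)"
      by (simp add: inner_axis' matrix_vector_mult_basis column_def)
    also have "\<dots> = axis i 1 \<bullet> (transpose X *v (\<Sigma> *v (X *v axis i 1)))"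
      by (simp only: matrix_vector_mul_assoc matrix_mul_assoc)
    also have "\<dots> = (X *v axis i 1) \<bullet> (\<Sigma> *v (X *v axis i 1))"
      using dot_lmul_matrix[of "axis i 1" "transpose X" "\<Sigma> *v (X *v axis i 1)"]
        transpose_matrix_vector[of "transpose X" "axis i 1"] by (simp add: transpose_transpose)
    finally show ?thesis by (simp add: matrix_vector_mult_basis normalized)
  qed
  have "{\<omega> \<in> space M. spacing_statistic ?R (transpose X *v Y \<omega>) \<le> \<alpha>}
      = {\<omega> \<in> space M. spacing_statistic ?R (?\<mu> + transpose X *v \<xi> \<omega>) \<le> \<alpha>}"
    by (auto simp: model matrix_vector_right_distrib simp del: transpose_matrix_vector)
  then show ?thesis using spacing_test_power[OF prob corr diag level, of ?\<mu>] by simp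
qed

end
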